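(* Let $(G_1,\mathfrak{N}_1),(G_2,\mathfrak{N}_2),\dots$ be an infinite sequence of pairs, each consisting of a finitely generated group $G_i$ and a normal subgroup $\mathfrak{N}_i$ of $G_i$. Let $c$ be an integer and suppose that $\mathrm{Dim}(R(G_i))=\mathrm{Dim}(R(G_i/\mathfrak{N}_i))=c$ for all $i$, and that the set of integers $\{N_c(R(G_i/\mathfrak{N}_i)) : i\ge 1\}$ is infinite. Then: (i) The sequence has an infinite subsequence $S^2$ with the property that for any two different pairs $(G_j,\mathfrak{N}_j)$, $(G_k,\mathfrak{N}_k)$ in $S^2$ one has $N_c(R(G_j))\neq N_c(R(G_k))$. (ii) For different pairs $(G_j,\mathfrak{N}_j)$, $(G_k,\mathfrak{N}_k)$ in $S^2$, $R(G_j)\not\cong R(G_k)$. (iii) The set of groups $S_2=\{G : G \text{ occurs in some term of } S^2\}$ can be well ordered using the function $N_c$, that is, by comparing the values $N_c(R(G))$ for $G\in S_2$.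
   Context: For a finitely generated group $G$ with generators $x_1,\dots,x_n$, $R(G)=\mathrm{Hom}(G,SL_2\mathbb{C})$ is the representation variety of $G$: the complex affine algebraic set of all $n$-tuples in $(SL_2\mathbb{C})^n$ satisfying the relations of $G$. Up to isomorphism of algebraic varieties it does not depend on the chosen finite generating set. $\mathrm{Dim}$ denotes the (Krull) dimension, and $\cong$ between representation varieties means isomorphism of algebraic varieties. For an algebraic variety $V$, $N_c(V)$ is the number of maximal irreducible components of $V$ (i.e. irreducible components in the Zariski topology) of dimension exactly $c$. *)

theory Defs
  imports "HOL-Analysis.Analysis" "HOL-Algebra.Generated_Groups"
begin

section \<open>Irreducible components and dimension of a topological space\<close>

definition irreducible_in :: "'a topology \<Rightarrow> 'a set \<Rightarrow> bool" where
  "irreducible_in X S \<longleftrightarrow> S \<subseteq> topspace X \<and> S \<noteq> {} \<and>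
     (\<forall>C D. closedin X C \<and> closedin X D \<and> S \<subseteq> C \<union> D \<longrightarrow> S \<subseteq> C \<or> S \<subseteq> D)"

definition irreducible_components :: "'a topology \<Rightarrow> 'a set set" where
  "irreducible_components X =
     {Z. irreducible_in X Z \<and> (\<forall>Z'. irreducible_in X Z' \<and> Z \<subseteq> Z' \<longrightarrow> Z' = Z)}"

text \<open>The supremum is taken in the extended reals, so that spaces of infinite dimension are
  covered and the empty space has dimension \<open>-\<infinity>\<close>.\<close>

definition krull_dim :: "'a topology \<Rightarrow> ereal" where
  "krull_dim X = (SUP n \<in> {n. \<exists>Z :: nat \<Rightarrow> 'a set.
       (\<forall>i\<le>n. closedin X (Z i) \<and> irreducible_in X (Z i)) \<and> (\<forall>i<n. Z i \<subset> Z (Suc i))}. ereal (real n))"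


section \<open>Affine algebraic sets\<close>

text \<open>For a finite index set \<open>I\<close>, affine space over the complex numbers with coordinates indexed
  by \<open>I\<close>. As the field is infinite, polynomials and polynomial functions are the same thing.\<close>

definition affine_space :: "'i set \<Rightarrow> ('i \<Rightarrow> complex) set" where
  "affine_space I = (\<Pi>\<^sub>E i\<in>I. UNIV)"

inductive_set poly_fun :: "'i set \<Rightarrow> (('i \<Rightarrow> complex) \<Rightarrow> complex) set" for I :: "'i set" where
  const: "(\<lambda>_. c) \<in> poly_fun I"
| coord: "i \<in> I \<Longrightarrow> (\<lambda>x. x i) \<in> poly_fun I"
| add: "f \<in> poly_fun I \<Longrightarrow> g \<in> poly_fun I \<Longrightarrow> (\<lambda>x. f x + g x) \<in> poly_fun I"
| mult: "f \<in> poly_fun I \<Longrightarrow> g \<in> poly_fun I \<Longrightarrow> (\<lambda>x. f x * g x) \<in> poly_fun I"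

definition zero_locus :: "'i set \<Rightarrow> (('i \<Rightarrow> complex) \<Rightarrow> complex) set \<Rightarrow> ('i \<Rightarrow> complex) set" where
  "zero_locus I F = {x \<in> affine_space I. \<forall>f\<in>F. f x = 0}"

definition zariski :: "'i set \<Rightarrow> ('i \<Rightarrow> complex) topology" where
  "zariski I = topology (\<lambda>U. \<exists>F \<subseteq> poly_fun I. U = affine_space I - zero_locus I F)"

lemma istopology_zariski:
  "istopology (\<lambda>U. \<exists>F \<subseteq> poly_fun I. U = affine_space I - zero_locus I F)"
  unfolding istopology_def
proof (intro conjI allI impI)
  fix S T
  assume "\<exists>F \<subseteq> poly_fun I. S = affine_space I - zero_locus I F"
    and "\<exists>F \<subseteq> poly_fun I. T = affine_space I - zero_locus I F"
  then obtain F H where F: "F \<subseteq> poly_fun I" "S = affine_space I - zero_locus I F"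
    and H: "H \<subseteq> poly_fun I" "T = affine_space I - zero_locus I H" by blast
  let ?P = "{\<lambda>x. f x * h x | f h. f \<in> F \<and> h \<in> H}"
  have "?P \<subseteq> poly_fun I" using F(1) H(1) by (auto intro: poly_fun.mult)
  moreover have "zero_locus I ?P = zero_locus I F \<union> zero_locus I H"
    unfolding zero_locus_def by force
  then have "S \<inter> T = affine_space I - zero_locus I ?P"
    unfolding F(2) H(2) by blast
  ultimately show "\<exists>F \<subseteq> poly_fun I. S \<inter> T = affine_space I - zero_locus I F"
    by (intro exI[of _ ?P] conjI)
next
  fix \<K> :: "('a \<Rightarrow> complex) set set"
  assume *: "\<forall>K\<in>\<K>. \<exists>F \<subseteq> poly_fun I. K = affine_space I - zero_locus I F"
  let ?F = "{f \<in> poly_fun I. affine_space I - zero_locus I {f} \<subseteq> \<Union>\<K>}"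
  have "\<Union>\<K> = affine_space I - zero_locus I ?F"
  proof
    show "\<Union>\<K> \<subseteq> affine_space I - zero_locus I ?F"
    proof
      fix x assume "x \<in> \<Union>\<K>"
      then obtain K F where K: "K \<in> \<K>" "x \<in> K" "F \<subseteq> poly_fun I" "K = affine_space I - zero_locus I F"
        using * by blast
      then obtain f where f: "f \<in> F" "f x \<noteq> 0" "x \<in> affine_space I"
        by (auto simp: zero_locus_def)
      have "affine_space I - zero_locus I {f} \<subseteq> K"
        unfolding K(4) using f(1) unfolding zero_locus_def by blast
      moreover have "f \<in> poly_fun I" using K(3) f(1) by (rule subsetD)
      ultimately have "f \<in> ?F" using K(1) by blast
      then show "x \<in> affine_space I - zero_locus I ?F"
        using f unfolding zero_locus_def by blast
    qed
    show "affine_space I - zero_locus I ?F \<subseteq> \<Union>\<K>"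
      unfolding zero_locus_def by blast
  qed
  then show "\<exists>F \<subseteq> poly_fun I. \<Union>\<K> = affine_space I - zero_locus I F"
    by (intro exI[of _ ?F] conjI) simp_all
qed

lemma topspace_zariski: "topspace (zariski I) = affine_space I"
proof -
  have "openin (zariski I) (affine_space I)"
    unfolding zariski_def topology_inverse'[OF istopology_zariski]
    by (rule exI[of _ "{\<lambda>_. 1}"]) (auto simp: zero_locus_def intro: poly_fun.const)
  moreover have "U \<subseteq> affine_space I" if "openin (zariski I) U" for U
    using that unfolding zariski_def topology_inverse'[OF istopology_zariski] by blast
  ultimately show ?thesis by (meson openin_subset openin_topspace subset_antisym)
qed

lemma closedin_zariski_iff: "closedin (zariski I) C \<longleftrightarrow> (\<exists>F \<subseteq> poly_fun I. C = zero_locus I F)"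
proof -
  have "zero_locus I F \<subseteq> affine_space I" for F
    by (auto simp: zero_locus_def)
  then have "C = zero_locus I F \<longleftrightarrow> C \<subseteq> affine_space I \<and> affine_space I - C = affine_space I - zero_locus I F" for F
    by blast
  then show ?thesis
    unfolding closedin_def topspace_zariski
    unfolding zariski_def topology_inverse'[OF istopology_zariski]
    by blast
qed

text \<open>An affine algebraic set is represented by the index set of its ambient affine space together
  with its set of points.\<close>

type_synonym 'i affine_set = "'i set \<times> ('i \<Rightarrow> complex) set"

definition variety_topology :: "'i affine_set \<Rightarrow> ('i \<Rightarrow> complex) topology" where
  "variety_topology V = subtopology (zariski (fst V)) (snd V)"

definition Dim :: "'i affine_set \<Rightarrow> ereal" where
  "Dim V = krull_dim (variety_topology V)"

definition num_components :: "int \<Rightarrow> 'i affine_set \<Rightarrow> nat" where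
  "num_components c V =
     card {Z \<in> irreducible_components (variety_topology V). Dim (fst V, Z) = ereal (of_int c)}"

definition regular_map :: "'i affine_set \<Rightarrow> 'j affine_set \<Rightarrow> (('i \<Rightarrow> complex) \<Rightarrow> ('j \<Rightarrow> complex)) \<Rightarrow> bool" where
  "regular_map V W \<phi> \<longleftrightarrow> \<phi> ` snd V \<subseteq> snd W \<and>
     (\<forall>j\<in>fst W. \<exists>f\<in>poly_fun (fst V). \<forall>x\<in>snd V. \<phi> x j = f x)"

definition isomorphic_varieties :: "'i affine_set \<Rightarrow> 'j affine_set \<Rightarrow> bool" where
  "isomorphic_varieties V W \<longleftrightarrow> (\<exists>\<phi> \<psi>. regular_map V W \<phi> \<and> regular_map W V \<psi> \<and>
     (\<forall>x\<in>snd V. \<psi> (\<phi> x) = x) \<and> (\<forall>y\<in>snd W. \<phi> (\<psi> y) = y))"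


section \<open>Representation varieties\<close>

definition SL2 :: "(complex^2^2) monoid" where
  "SL2 = \<lparr>carrier = {A. det A = 1}, mult = (**), one = mat 1\<rparr>"

lemma group_SL2: "group SL2"
proof (rule groupI, unfold SL2_def monoid.simps partial_object.simps mem_Collect_eq)
  fix A B :: "complex^2^2" assume "det A = 1" "det B = 1"
  then show "det (A ** B) = 1" by (simp only: det_mul mult_1_left)
next
  show "det (mat 1 :: complex^2^2) = 1" by (rule det_I)
next
  fix A B C :: "complex^2^2"
  show "A ** B ** C = A ** (B ** C)" by (simp only: matrix_mul_assoc)
next
  fix A :: "complex^2^2"
  show "mat 1 ** A = A" by (rule matrix_mul_lid)
next
  fix A :: "complex^2^2" assume A: "det A = 1"
  then have "invertible A" by (simp add: invertible_det_nz)
  then obtain B where B: "B ** A = mat 1" unfolding invertible_def by (elim exE conjE)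
  then have "det B = 1" using det_mul[of B A] by (simp only: A det_I mult_1_right)
  with B show "\<exists>B\<in>Collect (\<lambda>B. det B = 1). B ** A = mat 1"
    by (intro bexI[of _ B] CollectI)
qed

definition generating_tuple :: "('g, 'm) monoid_scheme \<Rightarrow> 'g list \<Rightarrow> bool" where
  "generating_tuple G xs \<longleftrightarrow> set xs \<subseteq> carrier G \<and> generate G (set xs) = carrier G"

text \<open>Words in the letters \<open>x\<^sub>k\<close>, written \<open>(k, True)\<close>, and \<open>x\<^sub>k\<inverse>\<close>, written \<open>(k, False)\<close>.\<close>

type_synonym group_word = "(nat \<times> bool) list"

definition words :: "nat \<Rightarrow> group_word set" where
  "words n = lists ({..<n} \<times> UNIV)"

fun word_val :: "('g, 'm) monoid_scheme \<Rightarrow> (nat \<Rightarrow> 'g) \<Rightarrow> group_word \<Rightarrow> 'g" where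
  "word_val G x [] = \<one>\<^bsub>G\<^esub>"
| "word_val G x ((k, b) # w) = (if b then x k else inv\<^bsub>G\<^esub> (x k)) \<otimes>\<^bsub>G\<^esub> word_val G x w"

definition relations :: "('g, 'm) monoid_scheme \<Rightarrow> 'g list \<Rightarrow> group_word set" where
  "relations G xs = {w \<in> words (length xs). word_val G (\<lambda>k. xs ! k) w = \<one>\<^bsub>G\<^esub>}"

text \<open>An \<open>n\<close>-tuple of matrices is a point of the affine space with the \<open>4n\<close> coordinates
  \<open>(k, i, j)\<close>: the \<open>(i, j)\<close> entry of the \<open>k\<close>-th matrix.\<close>

type_synonym rep_index = "nat \<times> 2 \<times> 2"

definition matrix_at :: "(rep_index \<Rightarrow> complex) \<Rightarrow> nat \<Rightarrow> complex^2^2" where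
  "matrix_at p k = (\<chi> i j. p (k, i, j))"

definition rep_variety :: "('g, 'm) monoid_scheme \<Rightarrow> 'g list \<Rightarrow> rep_index affine_set" where
  "rep_variety G xs =
     (let I = {..<length xs} \<times> UNIV \<times> UNIV in
      (I, {p \<in> affine_space I. (\<forall>k<length xs. matrix_at p k \<in> carrier SL2) \<and>
             (\<forall>w\<in>relations G xs. word_val SL2 (matrix_at p) w = \<one>\<^bsub>SL2\<^esub>)}))"

end

theory Submission
  imports Defs "HOL-Library.Function_Algebras"
begin

text \<open>Everything follows from one inequality: if \<open>Dim (R G) = c\<close>, then
  \<open>R (G / N)\<close> has at most as many components of dimension \<open>c\<close> as \<open>R G\<close>.
  The quotient map embeds \<open>R (G / N)\<close> into \<open>R G\<close> as the closed subset of those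
  representations that kill \<open>N\<close>. A component \<open>Z\<close> of dimension \<open>c\<close> of
  this subset is closed and irreducible in \<open>R G\<close>. If it were properly contained in
  a larger irreducible set, then each chain of closed irreducible subsets of \<open>Z\<close> could be
  prolonged by one step, and \<open>R G\<close> would have dimension at least \<open>c + 1\<close>
  (\<open>krull_dim_proper_subset\<close>). So \<open>Z\<close> is a component of \<open>R G\<close>.

  The numbers of components are cardinalities, and the cardinality of an infinite set is
  \<open>0\<close>; the inclusion of sets of components gives an inequality of numbers only because an
  affine algebraic set has finitely many components. This is Hilbert's basis theorem
  (\<open>noetherian_poly_fun\<close>) together with the decomposition of closed sets in Noetherian
  spaces (\<open>finite_irreducible_components\<close>).

  The generators of \<open>G / N\<close> are given independently of those of \<open>G\<close>. Two generating
  tuples of a group are words in each other, and evaluating these words gives mutually inverse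
  regular maps between the two representation varieties
  (\<open>rep_variety_independent_of_generators\<close>). Isomorphisms are homeomorphisms of the
  Zariski topologies, which preserve components and their dimensions
  (\<open>num_components_isomorphic\<close>), so one may pass to the images of the generators of
  \<open>G\<close>. Then both varieties lie in the same affine space, and the inclusion is literal.

  Since infinitely many values \<open>N\<^sub>c (R (G\<^sub>i / N\<^sub>i))\<close> are unbounded, so are the
  values \<open>N\<^sub>c (R G\<^sub>i)\<close>, and a subsequence can be chosen along which the latter increase
  strictly. Along it \<open>N\<^sub>c\<close> is injective: this separates the varieties up to
  isomorphism, and the groups are well ordered by their values in the natural numbers.\<close>


section \<open>Hilbert's basis theorem for rings of polynomial functions\<close>

definition subring_of :: "'a::comm_ring_1 set \<Rightarrow> bool" where
  "subring_of A \<longleftrightarrow> 1 \<in> A \<and> (\<forall>x\<in>A. - x \<in> A) \<and> (\<forall>x\<in>A. \<forall>y\<in>A. x + y \<in> A) \<and> (\<forall>x\<in>A. \<forall>y\<in>A. x * y \<in> A)"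

definition ideal_in :: "'a::comm_ring_1 set \<Rightarrow> 'a set \<Rightarrow> bool" where
  "ideal_in A J \<longleftrightarrow> J \<subseteq> A \<and> 0 \<in> J \<and> (\<forall>x\<in>J. \<forall>y\<in>J. x + y \<in> J) \<and> (\<forall>a\<in>A. \<forall>x\<in>J. a * x \<in> J)"

text \<open>The ascending chain condition is used, not finite generation of ideals: an ideal of
  \<open>A[t]\<close> is then controlled by the ideals of its leading coefficients, and chains of ideals by
  chains of these, without any choice of generators.\<close>

definition noetherian_subring :: "'a::comm_ring_1 set \<Rightarrow> bool" where
  "noetherian_subring A \<longleftrightarrow>
     (\<forall>J :: nat \<Rightarrow> 'a set. (\<forall>n. ideal_in A (J n)) \<and> incseq J \<longrightarrow> (\<exists>m. \<forall>n\<ge>m. J n = J m))"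

lemma ideal_in_diff:
  assumes "subring_of A" "ideal_in A J" "x \<in> J" "y \<in> J"
  shows "x - y \<in> J"
proof -
  have "- 1 \<in> A" using assms(1) by (auto simp: subring_of_def)
  then have "- 1 * y \<in> J" using assms(2,4) unfolding ideal_in_def by blast
  then have "x + - 1 * y \<in> J" using assms(2,3) unfolding ideal_in_def by blast
  then show ?thesis by simp
qed

text \<open>The \<open>A\<close>-combinations of \<open>1, t, \<dots>, t\<^bsup>n-1\<^esup>\<close>. If \<open>t\<close> is
  algebraic over \<open>A\<close>, an element can be written in this way in several manners; degrees
  and leading coefficients below always belong to one such representation.\<close>

primrec degree_below :: "'a::comm_ring_1 set \<Rightarrow> 'a \<Rightarrow> nat \<Rightarrow> 'a set" where
  "degree_below A t 0 = {0}"
| "degree_below A t (Suc n) = {g + a * t ^ n | g a. g \<in> degree_below A t n \<and> a \<in> A}"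

definition leading_coeffs :: "'a::comm_ring_1 set \<Rightarrow> 'a \<Rightarrow> nat \<Rightarrow> 'a set \<Rightarrow> 'a set" where
  "leading_coeffs A t n J = {a \<in> A. \<exists>g\<in>degree_below A t n. g + a * t ^ n \<in> J}"

context
  fixes A :: "'a::comm_ring_1 set" and t :: 'a
  assumes A: "subring_of A"
begin

lemma subring_closed:
  "0 \<in> A" "1 \<in> A" "x \<in> A \<Longrightarrow> - x \<in> A" "x \<in> A \<Longrightarrow> y \<in> A \<Longrightarrow> x + y \<in> A"
  "x \<in> A \<Longrightarrow> y \<in> A \<Longrightarrow> x * y \<in> A"
proof -
  have "1 + - 1 \<in> A" using A unfolding subring_of_def by blast
  then show "0 \<in> A" by simp
qed (use A in \<open>auto simp: subring_of_def\<close>)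

lemma degree_below_SucI:
  "g \<in> degree_below A t n \<Longrightarrow> a \<in> A \<Longrightarrow> f = g + a * t ^ n \<Longrightarrow> f \<in> degree_below A t (Suc n)"
  by auto

lemma degree_below_zero: "0 \<in> degree_below A t n"
proof (induction n)
  case (Suc n)
  then show ?case by (rule degree_below_SucI[where a = 0]) (simp_all add: subring_closed)
qed simp

lemma degree_below_add:
  "f \<in> degree_below A t n \<Longrightarrow> g \<in> degree_below A t n \<Longrightarrow> f + g \<in> degree_below A t n"
proof (induction n arbitrary: f g)
  case (Suc n)
  then obtain f' a g' b where "f = f' + a * t ^ n" "g = g' + b * t ^ n" "a \<in> A" "b \<in> A"
    "f' \<in> degree_below A t n" "g' \<in> degree_below A t n" by auto
  then show ?case
    by (intro degree_below_SucI[of "f' + g'" _ "a + b"] Suc.IH)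
      (simp_all add: subring_closed algebra_simps)
qed simp

lemma degree_below_scale:
  "a \<in> A \<Longrightarrow> f \<in> degree_below A t n \<Longrightarrow> a * f \<in> degree_below A t n"
proof (induction n arbitrary: f)
  case (Suc n)
  then obtain f' b where "f = f' + b * t ^ n" "b \<in> A" "f' \<in> degree_below A t n" by auto
  with Suc show ?case
    by (intro degree_below_SucI[of "a * f'" _ "a * b"] Suc.IH)
      (simp_all add: subring_closed algebra_simps)
qed simp

lemma degree_below_diff:
  assumes "f \<in> degree_below A t n" "g \<in> degree_below A t n"
  shows "f - g \<in> degree_below A t n"
proof -
  have "f + (- 1) * g \<in> degree_below A t n"
    using assms by (intro degree_below_add degree_below_scale subring_closed)
  then show ?thesis by simp
qed

lemma degree_below_mono: "m \<le> n \<Longrightarrow> degree_below A t m \<subseteq> degree_below A t n"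
proof (induction n rule: dec_induct)
  case (step n)
  have "degree_below A t n \<subseteq> degree_below A t (Suc n)"
    by (rule subsetI, rule degree_below_SucI[where a = 0]) (simp_all add: subring_closed)
  with step show ?case by blast
qed simp

lemma degree_below_shift: "f \<in> degree_below A t n \<Longrightarrow> t * f \<in> degree_below A t (Suc n)"
proof (induction n arbitrary: f)
  case 0
  then show ?case using degree_below_zero[of 1] by simp
next
  case (Suc n)
  then obtain f' b where "f = f' + b * t ^ n" "b \<in> A" "f' \<in> degree_below A t n" by auto
  then show ?case
    by (intro degree_below_SucI[of "t * f'" _ b] Suc.IH) (simp_all add: algebra_simps)
qed

lemma degree_below_mult:
  "f \<in> degree_below A t m \<Longrightarrow> g \<in> degree_below A t n \<Longrightarrow> f * g \<in> degree_below A t (m + n)"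
proof (induction m arbitrary: f)
  case 0
  then show ?case using degree_below_zero by simp
next
  case (Suc m)
  then obtain f' b where f: "f = f' + b * t ^ m" "b \<in> A" "f' \<in> degree_below A t m" by auto
  have "t ^ m * g \<in> degree_below A t (m + n)"
  proof (induction m)
    case 0
    then show ?case using Suc.prems(2) by simp
  next
    case (Suc m)
    then show ?case using degree_below_shift[of "t ^ m * g" "m + n"] by (simp add: algebra_simps)
  qed
  then have "f' * g + b * (t ^ m * g) \<in> degree_below A t (m + n)"
    by (rule degree_below_add[OF Suc.IH[OF f(3) Suc.prems(2)] degree_below_scale[OF f(2)]])
  then show ?case
    using f(1) degree_below_mono[of "m + n" "Suc m + n"] by (auto simp: algebra_simps)
qed

text \<open>Each leading coefficient ideal lives in the smaller ring \<open>A\<close>, so that the chain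
  condition of \<open>A\<close> applies to it.\<close>

lemma ideal_in_leading_coeffs:
  assumes "A \<subseteq> B" "ideal_in B J"
  shows "ideal_in A (leading_coeffs A t n J)"
  unfolding ideal_in_def
proof (intro conjI ballI)
  show "leading_coeffs A t n J \<subseteq> A" by (auto simp: leading_coeffs_def)
  have "0 + 0 * t ^ n \<in> J" using assms(2) by (simp add: ideal_in_def)
  then show "0 \<in> leading_coeffs A t n J"
    unfolding leading_coeffs_def using degree_below_zero subring_closed(1) by blast
next
  fix a b assume "a \<in> leading_coeffs A t n J" "b \<in> leading_coeffs A t n J"
  then obtain f g where *: "a \<in> A" "b \<in> A" "f \<in> degree_below A t n" "g \<in> degree_below A t n"
    "f + a * t ^ n \<in> J" "g + b * t ^ n \<in> J" by (auto simp: leading_coeffs_def)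
  then have "(f + a * t ^ n) + (g + b * t ^ n) \<in> J" using assms(2) unfolding ideal_in_def by blast
  then have "(f + g) + (a + b) * t ^ n \<in> J" by (simp add: algebra_simps)
  with * show "a + b \<in> leading_coeffs A t n J"
    unfolding leading_coeffs_def using degree_below_add subring_closed(4) by blast
next
  fix a b assume a: "a \<in> A" and "b \<in> leading_coeffs A t n J"
  then obtain g where *: "b \<in> A" "g \<in> degree_below A t n" "g + b * t ^ n \<in> J"
    by (auto simp: leading_coeffs_def)
  then have "a * (g + b * t ^ n) \<in> J" using a assms unfolding ideal_in_def by blast
  then have "a * g + (a * b) * t ^ n \<in> J" by (simp add: algebra_simps)
  with * a show "a * b \<in> leading_coeffs A t n J"
    unfolding leading_coeffs_def using degree_below_scale subring_closed(5) by blast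
qed

text \<open>Multiplication by \<open>t\<close> raises the degree and keeps the leading coefficient.\<close>

lemma leading_coeffs_mono_degree:
  assumes "t \<in> B" "ideal_in B J" "m \<le> n"
  shows "leading_coeffs A t m J \<subseteq> leading_coeffs A t n J"
  using assms(3)
proof (induction n rule: dec_induct)
  case (step n)
  have "leading_coeffs A t n J \<subseteq> leading_coeffs A t (Suc n) J"
  proof
    fix a assume "a \<in> leading_coeffs A t n J"
    then obtain g where *: "a \<in> A" "g \<in> degree_below A t n" "g + a * t ^ n \<in> J"
      by (auto simp: leading_coeffs_def)
    then have "t * (g + a * t ^ n) \<in> J" using assms unfolding ideal_in_def by blast
    then have "t * g + a * t ^ Suc n \<in> J" by (simp add: algebra_simps)
    then show "a \<in> leading_coeffs A t (Suc n) J"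
      unfolding leading_coeffs_def using * degree_below_shift by blast
  qed
  with step show ?case by blast
qed simp

text \<open>Subtracting an element of the smaller ideal with the same leading coefficient lowers the
  degree of an element of the larger one.\<close>

lemma ideal_eq_if_leading_coeffs_eq:
  assumes B: "subring_of B" "B \<subseteq> (\<Union>n. degree_below A t n)"
    and J: "ideal_in B J" "ideal_in B J'" "J \<subseteq> J'"
    and eq: "\<And>n. leading_coeffs A t n J = leading_coeffs A t n J'"
  shows "J = J'"
proof -
  have *: "f \<in> J" if "f \<in> J'" "f \<in> degree_below A t n" for f n
    using that
  proof (induction n arbitrary: f)
    case 0
    then show ?case using J(1) by (simp add: ideal_in_def)
  next
    case (Suc n)
    then obtain g a where g: "f = g + a * t ^ n" "g \<in> degree_below A t n" "a \<in> A" by auto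
    then have "a \<in> leading_coeffs A t n J'" using Suc.prems(1) by (auto simp: leading_coeffs_def)
    then obtain h where h: "h \<in> degree_below A t n" "h + a * t ^ n \<in> J"
      unfolding eq[symmetric] by (auto simp: leading_coeffs_def)
    have "f - (h + a * t ^ n) \<in> J'"
      using h J Suc.prems(1) by (intro ideal_in_diff[OF B(1)]) auto
    moreover have diff: "f - (h + a * t ^ n) = g - h" using g(1) by simp
    ultimately have "g - h \<in> J" using Suc.IH degree_below_diff g(2) h(1) by metis
    then have "(g - h) + (h + a * t ^ n) \<in> J" using h(2) J(1) unfolding ideal_in_def by blast
    then show ?case using g(1) by simp
  qed
  show ?thesis
  proof
    show "J' \<subseteq> J"
    proof
      fix f assume f: "f \<in> J'"
      then have "f \<in> B" using J(2) by (auto simp: ideal_in_def)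
      then obtain n where "f \<in> degree_below A t n" using B(2) by blast
      then show "f \<in> J" using * f by blast
    qed
  qed (rule J(3))
qed

text \<open>For an ascending chain \<open>J\<^sub>m\<close> of ideals of \<open>A[t]\<close> the ideals of leading
  coefficients in degree \<open>n\<close> grow both with \<open>m\<close> and with \<open>n\<close>. Let the diagonal
  \<open>m = n\<close> be constant from \<open>M\<close> on. Then for all \<open>m, n \<ge> M\<close> they equal the
  value at \<open>(M, M)\<close>, and only the finitely many degrees below \<open>M\<close> remain, each of which
  stabilises by itself.\<close>

lemma noetherian_adjoin:
  assumes acc: "noetherian_subring A"
    and B: "subring_of B" "A \<subseteq> B" "t \<in> B" "B \<subseteq> (\<Union>n. degree_below A t n)"
  shows "noetherian_subring B"
  unfolding noetherian_subring_def
proof (intro allI impI, elim conjE)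
  fix J :: "nat \<Rightarrow> 'a set"
  assume J: "\<forall>n. ideal_in B (J n)" and inc: "incseq J"
  define L where "L n m = leading_coeffs A t n (J m)" for n m
  have ideal: "ideal_in A (L n m)" for n m
    unfolding L_def using B(2) J ideal_in_leading_coeffs by blast
  have mono: "L n m \<subseteq> L n' m'" if "n \<le> n'" "m \<le> m'" for n n' m m'
  proof -
    have "L n m \<subseteq> L n' m"
      unfolding L_def using that J B(3) by (intro leading_coeffs_mono_degree[of B]) auto
    also have "\<dots> \<subseteq> L n' m'"
      unfolding L_def leading_coeffs_def using incseqD[OF inc that(2)] by blast
    finally show ?thesis .
  qed
  have "\<exists>M. \<forall>n\<ge>M. L n n = L M M"
    using acc[unfolded noetherian_subring_def, rule_format, of "\<lambda>n. L n n"] ideal mono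
    by (simp add: incseq_def)
  then obtain M where M: "\<And>n. n \<ge> M \<Longrightarrow> L n n = L M M" by blast
  have "\<exists>k. \<forall>m\<ge>k. L n m = L n k" for n
    using acc[unfolded noetherian_subring_def, rule_format, of "\<lambda>m. L n m"] ideal mono
    by (simp add: incseq_def)
  then obtain k where k: "\<And>n m. m \<ge> k n \<Longrightarrow> L n m = L n (k n)" by metis
  define K where "K = Max (insert M (k ` {..<M}))"
  have K: "M \<le> K" "\<And>n. n < M \<Longrightarrow> k n \<le> K" unfolding K_def by auto
  show "\<exists>m. \<forall>n\<ge>m. J n = J m"
  proof (intro exI[of _ K] allI impI)
    fix m assume m: "m \<ge> K"
    have "L n K = L n m" for n
    proof (cases "n < M")
      case True
      then show ?thesis using k[of n K] k[of n m] K(2)[of n] m by simp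
    next
      case False
      have stable: "L n j = L M M" if "j \<ge> M" for j
        using mono[of M n M j] mono[of n "max n j" j "max n j"] M[of "max n j"] False that by force
      show ?thesis using stable[of K] stable[of m] K(1) m by simp
    qed
    then have "J K = J m"
      unfolding L_def
      by (rule ideal_eq_if_leading_coeffs_eq[OF B(1,4) J[rule_format] J[rule_format] incseqD[OF inc m]])
    then show "J m = J K" by simp
  qed
qed

end

lemma poly_fun_mono: "f \<in> poly_fun I \<Longrightarrow> I \<subseteq> I' \<Longrightarrow> f \<in> poly_fun I'"
  by (induction rule: poly_fun.induct) (auto intro: poly_fun.intros)

lemma subring_poly_fun: "subring_of (poly_fun I)"
proof -
  have "- f \<in> poly_fun I" if "f \<in> poly_fun I" for f
    using poly_fun.mult[OF poly_fun.const[of "- 1"] that] by (simp add: fun_Compl_def)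
  then show ?thesis
    unfolding subring_of_def
    using poly_fun.const[of 1 I] poly_fun.add[of _ I] poly_fun.mult[of _ I]
    by (simp add: one_fun_def plus_fun_def times_fun_def)
qed

text \<open>Powers of the new coordinate can be collected in every polynomial.\<close>

lemma poly_fun_insert:
  "poly_fun (insert i I) \<subseteq> (\<Union>n. degree_below (poly_fun I) (\<lambda>x. x i) n)"
proof
  let ?D = "degree_below (poly_fun I) (\<lambda>x. x i)"
  note S = subring_poly_fun[of I]
  have base: "f \<in> ?D 1" if "f \<in> poly_fun I" for f
    using that by simp
  fix f assume "f \<in> poly_fun (insert i I)"
  then show "f \<in> (\<Union>n. ?D n)"
  proof induction
    case (const c)
    then show ?case using base[OF poly_fun.const] by blast
  next
    case (coord j)
    show ?case
    proof (cases "j = i")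
      case True
      have "(\<lambda>x. x i) \<in> ?D (Suc 1)"
        by (rule degree_below_SucI[OF S degree_below_zero[OF S] subring_closed(2)[OF S]]) simp
      with True show ?thesis by blast
    next
      case False
      with coord show ?thesis using base[OF poly_fun.coord[of j I]] by blast
    qed
  next
    case (add f g)
    then obtain m n where "f \<in> ?D m" "g \<in> ?D n" by blast
    then have "f + g \<in> ?D (max m n)"
      using degree_below_mono[OF S, of m "max m n"] degree_below_mono[OF S, of n "max m n"]
      by (intro degree_below_add[OF S]) auto
    then show ?case unfolding plus_fun_def by blast
  next
    case (mult f g)
    then obtain m n where "f \<in> ?D m" "g \<in> ?D n" by blast
    then have "f * g \<in> ?D (m + n)" by (rule degree_below_mult[OF S])
    then show ?case unfolding times_fun_def by blast
  qed
qed

text \<open>Without coordinates only the constants remain, a field, whose ideals are \<open>0\<close> and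
  the whole ring.\<close>

lemma noetherian_poly_fun_empty: "noetherian_subring (poly_fun {})"
  unfolding noetherian_subring_def
proof (intro allI impI, elim conjE)
  fix J :: "nat \<Rightarrow> (('a \<Rightarrow> complex) \<Rightarrow> complex) set"
  assume J: "\<forall>n. ideal_in (poly_fun {}) (J n)" and inc: "incseq J"
  have const: "\<exists>c. f = (\<lambda>_. c)" if "f \<in> poly_fun {}" for f :: "('a \<Rightarrow> complex) \<Rightarrow> complex"
    using that by induction auto
  show "\<exists>m. \<forall>n\<ge>m. J n = J m"
  proof (cases "\<exists>m f. f \<in> J m \<and> f \<noteq> 0")
    case True
    then obtain m f where f: "f \<in> J m" "f \<noteq> 0" by blast
    then obtain c where c: "f = (\<lambda>_. c)" "c \<noteq> 0"
      using const J unfolding ideal_in_def zero_fun_def by blast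
    have "J n = poly_fun {}" if "n \<ge> m" for n
    proof
      show "J n \<subseteq> poly_fun {}" using J by (auto simp: ideal_in_def)
      show "poly_fun {} \<subseteq> J n"
      proof
        fix g :: "('a \<Rightarrow> complex) \<Rightarrow> complex" assume "g \<in> poly_fun {}"
        then have "g * (\<lambda>_. 1 / c) \<in> poly_fun {}"
          unfolding times_fun_def by (intro poly_fun.mult poly_fun.const)
        moreover have "f \<in> J n" using f(1) incseqD[OF inc that] by blast
        ultimately have "(g * (\<lambda>_. 1 / c)) * f \<in> J n" using J unfolding ideal_in_def by blast
        then show "g \<in> J n" using c by (simp add: times_fun_def)
      qed
    qed
    then show ?thesis by blast
  next
    case False
    have "J n = {0}" for n
    proof -
      have "0 \<in> J n" using J by (simp add: ideal_in_def)
      with False show ?thesis by blast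
    qed
    then show ?thesis by simp
  qed
qed

theorem noetherian_poly_fun: "finite I \<Longrightarrow> noetherian_subring (poly_fun I)"
proof (induction I rule: finite_induct)
  case empty
  show ?case by (rule noetherian_poly_fun_empty)
next
  case (insert i I)
  show ?case
    by (rule noetherian_adjoin[OF subring_poly_fun insert.IH subring_poly_fun _ _ poly_fun_insert])
      (auto intro: poly_fun_mono poly_fun.coord)
qed


section \<open>Irreducible components of Noetherian spaces\<close>

text \<open>Stated as well-foundedness, the descending chain condition on closed sets is directly an
  induction principle for them.\<close>

definition noetherian_space :: "'a topology \<Rightarrow> bool" where
  "noetherian_space X \<longleftrightarrow> wf {(C, D). closedin X C \<and> closedin X D \<and> C \<subset> D}"

lemma zero_locus_vanishing_ideal:
  assumes "closedin (zariski I) C"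
  shows "C = zero_locus I {f \<in> poly_fun I. \<forall>x\<in>C. f x = 0}"
proof -
  obtain F where F: "F \<subseteq> poly_fun I" "C = zero_locus I F"
    using assms unfolding closedin_zariski_iff by blast
  show ?thesis
  proof (intro equalityI subsetI)
    fix x assume "x \<in> C"
    then show "x \<in> zero_locus I {f \<in> poly_fun I. \<forall>x\<in>C. f x = 0}"
      using F(2) by (simp add: zero_locus_def)
  next
    fix x assume x: "x \<in> zero_locus I {f \<in> poly_fun I. \<forall>x\<in>C. f x = 0}"
    have "f x = 0" if "f \<in> F" for f
    proof -
      have "f \<in> poly_fun I" "\<forall>x\<in>C. f x = 0" using F that by (auto simp: zero_locus_def)
      with x show ?thesis by (simp add: zero_locus_def)
    qed
    with x show "x \<in> C" unfolding F(2) by (simp add: zero_locus_def)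
  qed
qed

text \<open>A strictly descending sequence of closed sets has an ascending sequence of vanishing ideals.
  It stabilises, but a closed set is the zero locus of its vanishing ideal.\<close>

lemma noetherian_zariski:
  assumes "finite I"
  shows "noetherian_space (zariski I)"
  unfolding noetherian_space_def wf_iff_no_infinite_down_chain
proof (rule notI, elim exE)
  fix C
  assume "\<forall>n. (C (Suc n), C n) \<in> {(C, D). closedin (zariski I) C \<and> closedin (zariski I) D \<and> C \<subset> D}"
  then have closed: "closedin (zariski I) (C n)" and less: "C (Suc n) \<subset> C n" for n
    by auto
  define J where "J n = {f \<in> poly_fun I. \<forall>x\<in>C n. f x = 0}" for n
  have "ideal_in (poly_fun I) (J n)" for n
    unfolding ideal_in_def J_def zero_fun_def plus_fun_def times_fun_def
    by (auto intro: poly_fun.intros)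
  moreover have "incseq J"
    unfolding J_def using less by (intro incseq_SucI) blast
  ultimately obtain m where m: "J (Suc m) = J m"
    using noetherian_poly_fun[OF assms] unfolding noetherian_subring_def by (meson le_SucI order_refl)
  have "C n = zero_locus I (J n)" for n
    unfolding J_def by (rule zero_locus_vanishing_ideal[OF closed])
  with m less show False by (metis psubset_eq)
qed

lemma noetherian_subtopology:
  assumes "noetherian_space X" "closedin X S"
  shows "noetherian_space (subtopology X S)"
  unfolding noetherian_space_def
  by (rule wf_subset[OF assms(1)[unfolded noetherian_space_def]])
    (use assms(2) in \<open>auto simp: closedin_closed_subtopology\<close>)

text \<open>A reducible closed set is the union of two smaller closed sets, which by Noetherian induction
  are already decomposed.\<close>

lemma noetherian_irreducible_decomposition:
  assumes "noetherian_space X" "closedin X C"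
  shows "\<exists>\<F>. finite \<F> \<and> \<Union>\<F> = C \<and> (\<forall>F\<in>\<F>. closedin X F \<and> irreducible_in X F)"
  using assms(1)[unfolded noetherian_space_def] assms(2)
proof (induction C rule: wf_induct_rule)
  case (less C)
  consider "C = {}" | "irreducible_in X C" | "C \<noteq> {}" "\<not> irreducible_in X C" by blast
  then show ?case
  proof cases
    case 1
    then show ?thesis by (intro exI[of _ "{}"]) simp
  next
    case 2
    then show ?thesis using less.prems by (intro exI[of _ "{C}"]) simp
  next
    case 3
    then obtain D E where DE: "closedin X D" "closedin X E" "C \<subseteq> D \<union> E" "\<not> C \<subseteq> D" "\<not> C \<subseteq> E"
      using closedin_subset[OF less.prems] unfolding irreducible_in_def by blast
    have "closedin X (C \<inter> D)" "closedin X (C \<inter> E)" "C \<inter> D \<subset> C" "C \<inter> E \<subset> C"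
      using DE less.prems by auto
    then obtain \<F> \<G> where
      "finite \<F>" "\<Union>\<F> = C \<inter> D" "\<forall>F\<in>\<F>. closedin X F \<and> irreducible_in X F"
      "finite \<G>" "\<Union>\<G> = C \<inter> E" "\<forall>F\<in>\<G>. closedin X F \<and> irreducible_in X F"
      using less.IH[of "C \<inter> D"] less.IH[of "C \<inter> E"] less.prems by auto
    then show ?thesis using DE(3) by (intro exI[of _ "\<F> \<union> \<G>"]) auto
  qed
qed

lemma irreducible_in_finite_Union:
  assumes "finite \<F>" "irreducible_in X Z" "\<forall>F\<in>\<F>. closedin X F" "Z \<subseteq> \<Union>\<F>"
  shows "\<exists>F\<in>\<F>. Z \<subseteq> F"
  using assms(1,3,4)
proof (induction \<F> rule: finite_induct)
  case empty
  then show ?case using assms(2) by (simp add: irreducible_in_def)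
next
  case (insert F \<F>)
  then have "closedin X F" "closedin X (\<Union>\<F>)" "Z \<subseteq> F \<union> \<Union>\<F>"
    by (auto intro: closedin_Union)
  then have "Z \<subseteq> F \<or> Z \<subseteq> \<Union>\<F>" using assms(2) unfolding irreducible_in_def by blast
  then show ?case using insert by auto
qed

text \<open>A component lies in one of the finitely many irreducible pieces of the whole space, and by
  maximality it is equal to this piece.\<close>

lemma finite_irreducible_components:
  assumes "noetherian_space X"
  shows "finite (irreducible_components X)"
proof -
  obtain \<F> where F: "finite \<F>" "\<Union>\<F> = topspace X" "\<forall>F\<in>\<F>. closedin X F \<and> irreducible_in X F"
    using noetherian_irreducible_decomposition[OF assms closedin_topspace] by blast
  have "irreducible_components X \<subseteq> \<F>"
  proof
    fix Z assume Z: "Z \<in> irreducible_components X"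
    then have "irreducible_in X Z" by (simp add: irreducible_components_def)
    then obtain F' where "F' \<in> \<F>" "Z \<subseteq> F'"
      using irreducible_in_finite_Union[OF F(1), of X Z] F by (auto simp: irreducible_in_def)
    then show "Z \<in> \<F>" using Z F(3) by (auto simp: irreducible_components_def)
  qed
  then show ?thesis using F(1) finite_subset by blast
qed

lemma irreducible_in_subtopology:
  "irreducible_in (subtopology X S) Z \<longleftrightarrow> irreducible_in X Z \<and> Z \<subseteq> S"
proof
  assume L: "irreducible_in (subtopology X S) Z"
  then have Z: "Z \<subseteq> topspace X" "Z \<subseteq> S" "Z \<noteq> {}" by (auto simp: irreducible_in_def)
  have "Z \<subseteq> C \<or> Z \<subseteq> D" if "closedin X C" "closedin X D" "Z \<subseteq> C \<union> D" for C D
  proof -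
    have "closedin (subtopology X S) (C \<inter> S)" "closedin (subtopology X S) (D \<inter> S)"
      using that by (auto simp: closedin_subtopology)
    moreover have "Z \<subseteq> (C \<inter> S) \<union> (D \<inter> S)" using that(3) Z(2) by blast
    ultimately show ?thesis using L unfolding irreducible_in_def by blast
  qed
  with Z show "irreducible_in X Z \<and> Z \<subseteq> S" unfolding irreducible_in_def by blast
next
  assume R: "irreducible_in X Z \<and> Z \<subseteq> S"
  have "Z \<subseteq> C \<or> Z \<subseteq> D"
    if cl: "closedin (subtopology X S) C" "closedin (subtopology X S) D" and "Z \<subseteq> C \<union> D" for C D
  proof -
    obtain C' D' where "closedin X C'" "closedin X D'" "C = C' \<inter> S" "D = D' \<inter> S"
      using cl by (auto simp: closedin_subtopology)
    with that R show ?thesis unfolding irreducible_in_def by blast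
  qed
  with R show "irreducible_in (subtopology X S) Z" unfolding irreducible_in_def by auto
qed

lemma irreducible_in_closure_of:
  assumes "irreducible_in X Z"
  shows "irreducible_in X (X closure_of Z)"
proof -
  have Z: "Z \<subseteq> X closure_of Z"
    using assms by (simp add: closure_of_subset irreducible_in_def)
  have "X closure_of Z \<subseteq> C \<or> X closure_of Z \<subseteq> D"
    if cl: "closedin X C" "closedin X D" and "X closure_of Z \<subseteq> C \<union> D" for C D
  proof -
    have "Z \<subseteq> C \<or> Z \<subseteq> D" using assms that Z unfolding irreducible_in_def by blast
    then show ?thesis using cl closure_of_minimal by blast
  qed
  moreover have "X closure_of Z \<noteq> {}" using Z assms unfolding irreducible_in_def by blast
  ultimately show ?thesis by (simp add: irreducible_in_def closure_of_subset_topspace)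
qed

lemma closedin_irreducible_component:
  assumes "Z \<in> irreducible_components X"
  shows "closedin X Z"
proof -
  have Z: "irreducible_in X Z" using assms by (simp add: irreducible_components_def)
  then have "Z \<subseteq> X closure_of Z" by (simp add: closure_of_subset irreducible_in_def)
  then have "X closure_of Z = Z"
    using assms irreducible_in_closure_of[OF Z] unfolding irreducible_components_def by blast
  then show ?thesis by (metis closedin_closure_of)
qed


section \<open>Components of top dimension\<close>

text \<open>A chain in \<open>Z\<close> is prolonged by the closure of \<open>Z'\<close>.\<close>

lemma krull_dim_proper_subset:
  assumes Z: "closedin X Z" and Z': "irreducible_in X Z'" "Z \<subset> Z'"
  shows "krull_dim (subtopology X Z) + 1 \<le> krull_dim X"
proof -
  let ?chain = "\<lambda>X n (C :: nat \<Rightarrow> 'a set).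
    (\<forall>i\<le>n. closedin X (C i) \<and> irreducible_in X (C i)) \<and> (\<forall>i<n. C i \<subset> C (Suc i))"
  have step: "ereal (real n) + 1 \<le> krull_dim X" if C: "?chain (subtopology X Z) n C" for n C
  proof -
    have chain: "\<forall>i<n. C i \<subset> C (Suc i)" using C by blast
    define C' where "C' i = (if i \<le> n then C i else X closure_of Z')" for i
    have C: "closedin X (C i)" "irreducible_in X (C i)" "C i \<subseteq> Z" if "i \<le> n" for i
      using C that Z by (auto simp: irreducible_in_subtopology closedin_closed_subtopology)
    have top: "Z \<subset> X closure_of Z'"
      using Z' closure_of_subset[of Z' X] unfolding irreducible_in_def by blast
    have "closedin X (C' i) \<and> irreducible_in X (C' i)" for i
      using C irreducible_in_closure_of[OF Z'(1)] by (simp add: C'_def)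
    moreover have "C' i \<subset> C' (Suc i)" if "i < Suc n" for i
    proof (cases "i = n")
      case True
      then show ?thesis using top C(3)[of n] by (simp add: C'_def subset_psubset_trans)
    next
      case False
      then show ?thesis using chain that by (simp add: C'_def)
    qed
    ultimately have "?chain X (Suc n) C'" by blast
    then have "ereal (real (Suc n)) \<le> krull_dim X"
      unfolding krull_dim_def by (intro SUP_upper) blast
    then show ?thesis by (simp add: add.commute)
  qed
  have "ereal (real n) \<le> krull_dim X - 1" if "?chain (subtopology X Z) n C" for n C
    using step[OF that] by (simp add: ereal_le_minus)
  then have "krull_dim (subtopology X Z) \<le> krull_dim X - 1"
    unfolding krull_dim_def[of "subtopology X Z"] by (intro SUP_least) blast
  then show ?thesis by (simp add: ereal_le_minus)
qed

lemma top_dim_component_of_closed_subspace: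
  assumes S: "closedin X S" and dim: "krull_dim X = ereal d"
    and Z: "Z \<in> irreducible_components (subtopology X S)" "krull_dim (subtopology X Z) = ereal d"
  shows "Z \<in> irreducible_components X"
proof -
  have "closedin X Z"
    using closedin_irreducible_component[OF Z(1)] S by (simp add: closedin_closed_subtopology)
  then have "\<not> Z \<subset> Z'" if "irreducible_in X Z'" for Z'
    using krull_dim_proper_subset[of X Z Z'] that dim Z(2) by (auto simp: one_ereal_def)
  moreover have "irreducible_in X Z"
    using Z(1) by (simp add: irreducible_components_def irreducible_in_subtopology)
  ultimately show ?thesis unfolding irreducible_components_def by blast
qed

text \<open>Components of dimension \<open>c\<close> of the smaller set are components of the larger one, by
  \<open>top_dim_component_of_closed_subspace\<close>; comparing the numbers requires that the larger set
  has only finitely many of them.\<close>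

lemma num_components_closed_subset:
  assumes fin: "finite I" and W: "closedin (zariski I) W" and V: "closedin (zariski I) V"
    and sub: "W \<subseteq> V" and dim: "Dim (I, V) = ereal (of_int c)"
  shows "num_components c (I, W) \<le> num_components c (I, V)"
proof -
  let ?X = "variety_topology (I, V)"
  have WX: "variety_topology (I, W) = subtopology ?X W"
    using sub by (simp add: variety_topology_def subtopology_subtopology Int_absorb1)
  have cl: "closedin ?X W"
    using W V sub by (simp add: variety_topology_def closedin_closed_subtopology)
  have noeth: "noetherian_space ?X"
    using noetherian_subtopology[OF noetherian_zariski[OF fin] V] by (simp add: variety_topology_def)
  have "Z \<in> irreducible_components ?X"
    if Z: "Z \<in> irreducible_components (variety_topology (I, W))" "Dim (I, Z) = ereal (of_int c)" for Z
  proof (rule top_dim_component_of_closed_subspace[OF cl])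
    show "krull_dim ?X = ereal (of_int c)" using dim by (simp add: Dim_def)
    show "Z \<in> irreducible_components (subtopology ?X W)" using Z(1) WX by simp
    then have "Z \<subseteq> V"
      using sub by (auto simp: irreducible_components_def irreducible_in_subtopology)
    then show "krull_dim (subtopology ?X Z) = ereal (of_int c)"
      using Z(2) by (simp add: Dim_def variety_topology_def subtopology_subtopology Int_absorb1)
  qed
  then show ?thesis
    unfolding num_components_def
    using finite_irreducible_components[OF noeth] by (intro card_mono) auto
qed


section \<open>Invariance under isomorphism\<close>

lemma irreducible_in_homeomorphic_image:
  assumes f: "homeomorphic_map X Y f" and Z: "irreducible_in X Z"
  shows "irreducible_in Y (f ` Z)"
proof -
  have "f ` Z \<subseteq> C \<or> f ` Z \<subseteq> D"
    if cl: "closedin Y C" "closedin Y D" and sub: "f ` Z \<subseteq> C \<union> D" for C D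
  proof -
    have "continuous_map X Y f" using f by (rule homeomorphic_imp_continuous_map)
    then have "closedin X {x \<in> topspace X. f x \<in> C}" "closedin X {x \<in> topspace X. f x \<in> D}"
      using cl by (simp_all add: closedin_continuous_map_preimage)
    moreover have "Z \<subseteq> {x \<in> topspace X. f x \<in> C} \<union> {x \<in> topspace X. f x \<in> D}"
      using Z sub unfolding irreducible_in_def by blast
    ultimately show ?thesis using Z unfolding irreducible_in_def by blast
  qed
  moreover have "f ` Z \<subseteq> topspace Y"
    using Z homeomorphic_imp_surjective_map[OF f] unfolding irreducible_in_def by blast
  ultimately show ?thesis using Z by (simp add: irreducible_in_def)
qed

lemma krull_dim_le_homeomorphic:
  assumes f: "homeomorphic_map X Y f"
  shows "krull_dim X \<le> krull_dim Y"
  unfolding krull_dim_def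
proof (rule SUP_subset_mono, rule Collect_mono, rule impI, elim exE conjE)
  fix n and C :: "nat \<Rightarrow> 'a set"
  assume C: "\<forall>i\<le>n. closedin X (C i) \<and> irreducible_in X (C i)" "\<forall>i<n. C i \<subset> C (Suc i)"
  have inj: "inj_on f (topspace X)" using f by (rule homeomorphic_imp_injective_map)
  have "f ` C i \<subset> f ` C (Suc i)" if "i < n" for i
    using inj C that closedin_subset[of X "C (Suc i)"] closedin_subset[of X "C i"]
    by (intro psubsetI image_mono) (auto simp: inj_on_image_eq_iff)
  moreover have "closedin Y (f ` C i) \<and> irreducible_in Y (f ` C i)" if "i \<le> n" for i
    using C(1) that irreducible_in_homeomorphic_image[OF f] homeomorphic_map_closedness[OF f]
      closedin_subset by blast
  ultimately show "\<exists>Z. (\<forall>i\<le>n. closedin Y (Z i) \<and> irreducible_in Y (Z i)) \<and> (\<forall>i<n. Z i \<subset> Z (Suc i))"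
    by (intro exI[of _ "\<lambda>i. f ` C i"]) blast
qed simp

lemma krull_dim_homeomorphic_maps:
  assumes "homeomorphic_maps X Y f g"
  shows "krull_dim X = krull_dim Y"
proof (rule antisym)
  show "krull_dim X \<le> krull_dim Y"
    using assms homeomorphic_maps_imp_map krull_dim_le_homeomorphic by blast
  have "homeomorphic_maps Y X g f" using assms homeomorphic_maps_sym by blast
  then show "krull_dim Y \<le> krull_dim X"
    using homeomorphic_maps_imp_map krull_dim_le_homeomorphic by blast
qed

lemma image_fixed: "(\<And>x. x \<in> S \<Longrightarrow> h x = x) \<Longrightarrow> h ` S = S"
  by simp

lemma irreducible_component_homeomorphic_image:
  assumes fg: "homeomorphic_maps X Y f g" and Z: "Z \<in> irreducible_components X"
  shows "f ` Z \<in> irreducible_components Y"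
proof -
  have f: "homeomorphic_map X Y f" and g: "homeomorphic_map Y X g"
    using fg homeomorphic_maps_sym[of X Y f g] by (auto simp: homeomorphic_maps_imp_map)
  have inv: "\<And>x. x \<in> topspace X \<Longrightarrow> g (f x) = x" "\<And>y. y \<in> topspace Y \<Longrightarrow> f (g y) = y"
    using fg by (auto simp: homeomorphic_maps_def)
  have irr: "irreducible_in X Z" using Z by (simp add: irreducible_components_def)
  have "Z' = f ` Z" if Z': "irreducible_in Y Z'" "f ` Z \<subseteq> Z'" for Z'
  proof -
    have "g ` f ` Z = Z"
      using inv(1) irr unfolding irreducible_in_def image_image by (intro image_fixed) blast
    then have "Z \<subseteq> g ` Z'" using Z'(2) by blast
    then have "g ` Z' = Z"
      using Z irreducible_in_homeomorphic_image[OF g Z'(1)] unfolding irreducible_components_def by blast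
    moreover have "f ` g ` Z' = Z'"
      using inv(2) Z'(1) unfolding irreducible_in_def image_image by (intro image_fixed) blast
    ultimately show ?thesis by simp
  qed
  then show ?thesis
    using irreducible_in_homeomorphic_image[OF f irr] unfolding irreducible_components_def by blast
qed

lemma topspace_variety:
  "snd V \<subseteq> affine_space (fst V) \<Longrightarrow> topspace (variety_topology V) = snd V"
  by (simp add: variety_topology_def topspace_zariski Int_absorb1)

lemma poly_fun_pullback:
  assumes "regular_map V W \<phi>" "g \<in> poly_fun (fst W)"
  shows "\<exists>f\<in>poly_fun (fst V). \<forall>x\<in>snd V. g (\<phi> x) = f x"
  using assms(2)
proof induction
  case (const c)
  show ?case by (rule bexI[OF _ poly_fun.const[of c]]) simp
next
  case (coord j)
  then show ?case using assms(1) by (auto simp: regular_map_def)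
next
  case (add g h)
  then obtain g' h' where "g' \<in> poly_fun (fst V)" "\<forall>x\<in>snd V. g (\<phi> x) = g' x"
    "h' \<in> poly_fun (fst V)" "\<forall>x\<in>snd V. h (\<phi> x) = h' x" by blast
  then show ?case by (intro bexI[OF _ poly_fun.add[of g' _ h']]) simp_all
next
  case (mult g h)
  then obtain g' h' where "g' \<in> poly_fun (fst V)" "\<forall>x\<in>snd V. g (\<phi> x) = g' x"
    "h' \<in> poly_fun (fst V)" "\<forall>x\<in>snd V. h (\<phi> x) = h' x" by blast
  then show ?case by (intro bexI[OF _ poly_fun.mult[of g' _ h']]) simp_all
qed

lemma continuous_regular_map:
  assumes \<phi>: "regular_map V W \<phi>"
    and V: "snd V \<subseteq> affine_space (fst V)" and W: "snd W \<subseteq> affine_space (fst W)"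
  shows "continuous_map (variety_topology V) (variety_topology W) \<phi>"
  unfolding continuous_map_closedin topspace_variety[OF V] topspace_variety[OF W]
proof (intro conjI funcsetI allI impI)
  have im: "\<phi> x \<in> snd W" if "x \<in> snd V" for x using \<phi> that by (auto simp: regular_map_def)
  show "\<phi> x \<in> snd W" if "x \<in> snd V" for x using im that .
  fix C assume "closedin (variety_topology W) C"
  then obtain F where F: "F \<subseteq> poly_fun (fst W)" "C = zero_locus (fst W) F \<inter> snd W"
    by (auto simp: variety_topology_def closedin_subtopology closedin_zariski_iff)
  define F' where "F' = {f \<in> poly_fun (fst V). \<exists>g\<in>F. \<forall>x\<in>snd V. g (\<phi> x) = f x}"
  have "{x \<in> snd V. \<phi> x \<in> C} = zero_locus (fst V) F' \<inter> snd V"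
  proof (intro equalityI subsetI)
    fix x assume "x \<in> {x \<in> snd V. \<phi> x \<in> C}"
    then show "x \<in> zero_locus (fst V) F' \<inter> snd V"
      using F V by (auto simp: zero_locus_def F'_def)
  next
    fix x assume x: "x \<in> zero_locus (fst V) F' \<inter> snd V"
    have "g (\<phi> x) = 0" if g: "g \<in> F" for g
    proof -
      obtain f where "f \<in> poly_fun (fst V)" "\<forall>x\<in>snd V. g (\<phi> x) = f x"
        using poly_fun_pullback[OF \<phi> subsetD[OF F(1) g]] by blast
      with g x show ?thesis by (auto simp: zero_locus_def F'_def)
    qed
    with x im W F show "x \<in> {x \<in> snd V. \<phi> x \<in> C}" by (auto simp: zero_locus_def)
  qed
  moreover have "F' \<subseteq> poly_fun (fst V)" by (auto simp: F'_def)
  ultimately show "closedin (variety_topology V) {x \<in> snd V. \<phi> x \<in> C}"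
    unfolding variety_topology_def closedin_subtopology closedin_zariski_iff by blast
qed

lemma num_components_isomorphic:
  assumes iso: "isomorphic_varieties V W"
    and V: "snd V \<subseteq> affine_space (fst V)" and W: "snd W \<subseteq> affine_space (fst W)"
  shows "num_components c V = num_components c W"
proof -
  obtain \<phi> \<psi> where reg: "regular_map V W \<phi>" "regular_map W V \<psi>"
    and inv: "\<forall>x\<in>snd V. \<psi> (\<phi> x) = x" "\<forall>y\<in>snd W. \<phi> (\<psi> y) = y"
    using iso by (auto simp: isomorphic_varieties_def)
  let ?X = "variety_topology V" and ?Y = "variety_topology W"
  have hom: "homeomorphic_maps ?X ?Y \<phi> \<psi>"
    unfolding homeomorphic_maps_def
    using continuous_regular_map[OF reg(1) V W] continuous_regular_map[OF reg(2) W V] inv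
    by (simp add: topspace_variety V W)
  then have hom': "homeomorphic_maps ?Y ?X \<psi> \<phi>" using homeomorphic_maps_sym by blast
  have sub: "Z \<subseteq> snd V" if "Z \<in> irreducible_components ?X" for Z
    using that by (auto simp: irreducible_components_def irreducible_in_def topspace_variety V)
  have sub': "Z \<subseteq> snd W" if "Z \<in> irreducible_components ?Y" for Z
    using that by (auto simp: irreducible_components_def irreducible_in_def topspace_variety W)
  have dim: "Dim (fst V, Z) = Dim (fst W, \<phi> ` Z)" if "Z \<in> irreducible_components ?X" for Z
  proof -
    have Z: "Z \<subseteq> snd V" "\<phi> ` Z \<subseteq> snd W"
      using sub[OF that] reg(1) by (auto simp: regular_map_def)
    have "homeomorphic_maps (subtopology ?X Z) (subtopology ?Y (\<phi> ` Z)) \<phi> \<psi>"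
      using Z by (intro homeomorphic_maps_subtopologies_alt[OF hom])
        (auto simp: topspace_variety V W inv subsetD)
    then have "krull_dim (subtopology ?X Z) = krull_dim (subtopology ?Y (\<phi> ` Z))"
      by (rule krull_dim_homeomorphic_maps)
    then show ?thesis
      using Z by (simp add: Dim_def variety_topology_def subtopology_subtopology Int_absorb1)
  qed
  have "\<psi> ` \<phi> ` Z = Z" if "Z \<subseteq> snd V" for Z
    using inv(1) that unfolding image_image by (intro image_fixed) blast
  moreover have "\<phi> ` \<psi> ` Z = Z" if "Z \<subseteq> snd W" for Z
    using inv(2) that unfolding image_image by (intro image_fixed) blast
  ultimately have "bij_betw (image \<phi>)
    {Z \<in> irreducible_components ?X. Dim (fst V, Z) = ereal (of_int c)}
    {Z \<in> irreducible_components ?Y. Dim (fst W, Z) = ereal (of_int c)}"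
    using irreducible_component_homeomorphic_image[OF hom]
      irreducible_component_homeomorphic_image[OF hom'] dim sub sub'
    by (intro bij_betw_byWitness[where f' = "image \<psi>"]) (auto simp: image_subset_iff)
  then show ?thesis unfolding num_components_def by (rule bij_betw_same_card)
qed


section \<open>Words and generating tuples\<close>

text \<open>Only the first \<open>n\<close> letters matter. This is what allows tuples to be treated as functions
  on all natural numbers, with arbitrary values beyond the length of the tuple.\<close>

lemma word_val_cong:
  "w \<in> words n \<Longrightarrow> (\<And>k. k < n \<Longrightarrow> x k = y k) \<Longrightarrow> word_val G x w = word_val G y w"
  by (induction G x w rule: word_val.induct) (auto simp: words_def)

lemma words_Nil: "[] \<in> words n"
  by (simp add: words_def)

lemma words_append: "v \<in> words n \<Longrightarrow> w \<in> words n \<Longrightarrow> v @ w \<in> words n"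
  by (simp add: words_def)

definition inverse_word :: "group_word \<Rightarrow> group_word" where
  "inverse_word w = rev (map (\<lambda>(k, b). (k, \<not> b)) w)"

lemma words_inverse_word: "w \<in> words n \<Longrightarrow> inverse_word w \<in> words n"
  by (auto simp: words_def inverse_word_def)

definition subst_word :: "(nat \<Rightarrow> group_word) \<Rightarrow> group_word \<Rightarrow> group_word" where
  "subst_word v w = concat (map (\<lambda>(k, b). if b then v k else inverse_word (v k)) w)"

lemma words_subst_word:
  "w \<in> words m \<Longrightarrow> (\<And>k. k < m \<Longrightarrow> v k \<in> words n) \<Longrightarrow> subst_word v w \<in> words n"
proof (induction w)
  case (Cons a w)
  then show ?case
    using words_inverse_word[of "v (fst a)" n] words_append[of _ n]
    by (cases a) (auto simp: subst_word_def words_def)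
qed (simp add: subst_word_def words_def)

context Group.group
begin

lemma word_val_closed:
  "w \<in> words n \<Longrightarrow> (\<And>k. k < n \<Longrightarrow> x k \<in> carrier G) \<Longrightarrow> word_val G x w \<in> carrier G"
proof (induction w)
  case (Cons a w)
  then show ?case by (cases a) (auto simp: words_def)
qed simp

lemma word_val_append:
  assumes "v \<in> words n" "w \<in> words n" and x: "\<And>k. k < n \<Longrightarrow> x k \<in> carrier G"
  shows "word_val G x (v @ w) = word_val G x v \<otimes> word_val G x w"
  using assms(1)
proof (induction v)
  case Nil
  then show ?case using word_val_closed[OF assms(2) x] by simp
next
  case (Cons a v)
  obtain k b where a: "a = (k, b)" by (cases a)
  from Cons.prems have v: "v \<in> words n" and k: "k < n" by (auto simp: words_def a)
  then show ?case
    using Cons.IH[OF v] word_val_closed[OF assms(2) x] word_val_closed[OF v x] x[OF k]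
    by (simp add: a m_assoc)
qed

lemma word_val_inverse_word:
  assumes "w \<in> words n" and x: "\<And>k. k < n \<Longrightarrow> x k \<in> carrier G"
  shows "word_val G x (inverse_word w) = inv (word_val G x w)"
  using assms(1)
proof (induction w)
  case (Cons a w)
  obtain k b where a: "a = (k, b)" by (cases a)
  from Cons.prems have w: "w \<in> words n" and k: "k < n" by (auto simp: words_def a)
  then have "[(k, \<not> b)] \<in> words n" by (simp add: words_def)
  then have "word_val G x (inverse_word (a # w)) =
      word_val G x (inverse_word w) \<otimes> word_val G x [(k, \<not> b)]"
    using word_val_append[OF words_inverse_word[OF w] _ x] by (simp add: inverse_word_def a)
  then show ?case
    using Cons.IH[OF w] word_val_closed[OF w x] x[OF k] by (simp add: a inv_mult_group)
qed (simp add: inverse_word_def)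

lemma word_val_subst_word:
  assumes "w \<in> words m" and v: "\<And>k. k < m \<Longrightarrow> v k \<in> words n"
    and x: "\<And>k. k < n \<Longrightarrow> x k \<in> carrier G"
  shows "word_val G x (subst_word v w) = word_val G (\<lambda>k. word_val G x (v k)) w"
  using assms(1)
proof (induction w)
  case (Cons a w)
  obtain k b where a: "a = (k, b)" by (cases a)
  from Cons.prems have w: "w \<in> words m" and k: "k < m" by (auto simp: words_def a)
  have eq: "subst_word v (a # w) = (if b then v k else inverse_word (v k)) @ subst_word v w"
    by (simp add: subst_word_def a)
  have "(if b then v k else inverse_word (v k)) \<in> words n"
    using v[OF k] words_inverse_word by simp
  then have "word_val G x (subst_word v (a # w)) =
      word_val G x (if b then v k else inverse_word (v k)) \<otimes> word_val G x (subst_word v w)"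
    unfolding eq using words_subst_word[OF w v] x by (rule word_val_append)
  then show ?case
    using Cons.IH[OF w] word_val_inverse_word[OF v[OF k] x] by (simp add: a)
qed (simp add: subst_word_def)

lemma generate_eq_word_vals:
  assumes "set xs \<subseteq> carrier G"
  shows "generate G (set xs) = word_val G (\<lambda>k. xs ! k) ` words (length xs)"
proof (intro equalityI subsetI)
  have x: "xs ! k \<in> carrier G" if "k < length xs" for k using assms that by auto
  fix g assume "g \<in> generate G (set xs)"
  then show "g \<in> word_val G (\<lambda>k. xs ! k) ` words (length xs)"
  proof induction
    case one
    show ?case by (rule image_eqI[OF _ words_Nil]) simp
  next
    case (incl g)
    then obtain k where "k < length xs" "g = xs ! k" by (auto simp: in_set_conv_nth)
    then show ?case using x by (intro image_eqI[of _ _ "[(k, True)]"]) (simp_all add: words_def)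
  next
    case (inv g)
    then obtain k where "k < length xs" "g = xs ! k" by (auto simp: in_set_conv_nth)
    then show ?case using x by (intro image_eqI[of _ _ "[(k, False)]"]) (simp_all add: words_def)
  next
    case (eng g h)
    then obtain v w where vw: "v \<in> words (length xs)" "g = word_val G (\<lambda>k. xs ! k) v"
      "w \<in> words (length xs)" "h = word_val G (\<lambda>k. xs ! k) w" by blast
    have "word_val G (\<lambda>k. xs ! k) (v @ w) = g \<otimes> h"
      using word_val_append[OF vw(1,3) x] vw(2,4) by simp
    then show ?case using words_append[OF vw(1,3)] by (metis image_eqI)
  qed
next
  fix g assume "g \<in> word_val G (\<lambda>k. xs ! k) ` words (length xs)"
  then obtain w where w: "w \<in> words (length xs)" "g = word_val G (\<lambda>k. xs ! k) w" by blast
  have "word_val G (\<lambda>k. xs ! k) w \<in> generate G (set xs)"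
    using w(1)
  proof (induction w)
    case Nil
    show ?case by (simp add: generate.one)
  next
    case (Cons a w)
    obtain k b where a: "a = (k, b)" by (cases a)
    with Cons have "k < length xs" "word_val G (\<lambda>k. xs ! k) w \<in> generate G (set xs)"
      by (simp_all add: words_def)
    then show ?case
      using generate.incl[of "xs ! k" "set xs" G] generate.inv[of "xs ! k" "set xs" G]
      by (auto simp: a intro: generate.eng)
  qed
  then show "g \<in> generate G (set xs)" using w(2) by simp
qed

end

lemma generating_tuple_iff_words:
  assumes "Group.group G"
  shows "generating_tuple G xs \<longleftrightarrow> set xs \<subseteq> carrier G \<and>
    (\<forall>g\<in>carrier G. \<exists>w\<in>words (length xs). word_val G (\<lambda>k. xs ! k) w = g)"
proof -
  interpret Group.group G by (rule assms)
  show ?thesis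
  proof (cases "set xs \<subseteq> carrier G")
    case True
    then have "word_val G (\<lambda>k. xs ! k) ` words (length xs) \<subseteq> carrier G"
      by (intro image_subsetI word_val_closed[of _ "length xs"]) auto
    moreover have "carrier G \<subseteq> word_val G (\<lambda>k. xs ! k) ` words (length xs) \<longleftrightarrow>
        (\<forall>g\<in>carrier G. \<exists>w\<in>words (length xs). word_val G (\<lambda>k. xs ! k) w = g)"
      unfolding subset_iff image_iff Ball_def by (simp add: eq_commute)
    ultimately show ?thesis
      using True by (simp add: generating_tuple_def generate_eq_word_vals[OF True] set_eq_subset)
  qed (simp add: generating_tuple_def)
qed

lemma (in group_hom) word_val_hom:
  assumes "w \<in> words n" and x: "\<And>k. k < n \<Longrightarrow> x k \<in> carrier G"
  shows "word_val H (\<lambda>k. h (x k)) w = h (word_val G x w)"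
  using assms(1)
proof (induction w)
  case (Cons a w)
  obtain k b where a: "a = (k, b)" by (cases a)
  from Cons.prems have w: "w \<in> words n" and k: "k < n" by (auto simp: words_def a)
  then show ?case using Cons.IH[OF w] G.word_val_closed[OF w x] x[OF k] by (simp add: a)
qed simp

lemma (in group_hom) word_val_map_hom:
  assumes "set xs \<subseteq> carrier G" "w \<in> words (length xs)"
  shows "word_val H (\<lambda>k. map h xs ! k) w = h (word_val G (\<lambda>k. xs ! k) w)"
proof -
  have "word_val H (\<lambda>k. map h xs ! k) w = word_val H (\<lambda>k. h (xs ! k)) w"
    by (rule word_val_cong[OF assms(2)]) simp
  also have "\<dots> = h (word_val G (\<lambda>k. xs ! k) w)"
    by (rule word_val_hom[OF assms(2)]) (use assms(1) in auto)
  finally show ?thesis .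
qed

lemma (in group_hom) generating_tuple_map_hom:
  assumes "generating_tuple G xs" "h ` carrier G = carrier H"
  shows "generating_tuple H (map h xs)"
proof -
  have xs: "set xs \<subseteq> carrier G" using assms(1) by (simp add: generating_tuple_def)
  have "\<exists>w\<in>words (length xs). word_val H (\<lambda>k. map h xs ! k) w = g" if "g \<in> carrier H" for g
  proof -
    from that obtain g' where g': "g' \<in> carrier G" "g = h g'"
      unfolding assms(2)[symmetric] by blast
    then obtain w where "w \<in> words (length xs)" "word_val G (\<lambda>k. xs ! k) w = g'"
      using assms(1) by (auto simp: generating_tuple_iff_words[OF G.is_group])
    then show ?thesis using word_val_map_hom[OF xs] g'(2) by (intro bexI[of _ w]) simp_all
  qed
  moreover have "set (map h xs) \<subseteq> carrier H" using xs by auto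
  ultimately show ?thesis by (simp add: generating_tuple_iff_words[OF H.is_group])
qed

lemma (in group_hom) relations_map_hom:
  assumes "set xs \<subseteq> carrier G"
  shows "relations G xs \<subseteq> relations H (map h xs)"
proof
  fix w assume "w \<in> relations G xs"
  then have "w \<in> words (length xs)" "word_val G (\<lambda>k. xs ! k) w = \<one>\<^bsub>G\<^esub>"
    by (simp_all add: relations_def)
  then show "w \<in> relations H (map h xs)"
    using word_val_map_hom[OF assms] by (simp add: relations_def)
qed


section \<open>Representation varieties of groups and of their quotients\<close>

text \<open>The Cayley--Hamilton theorem \<open>A\<^sup>2 - tr A \<cdot> A + 1 = 0\<close> for determinant \<open>1\<close>.
  Hence the entries of the inverse are polynomials in the entries of \<open>A\<close>.\<close>

lemma inv_SL2:
  assumes "A \<in> carrier SL2"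
  shows "inv\<^bsub>SL2\<^esub> A = mat (A $ 1 $ 1 + A $ 2 $ 2) - A" (is "_ = ?B")
proof -
  interpret SL2: Group.group SL2 by (rule group_SL2)
  have det: "A $ 1 $ 1 * A $ 2 $ 2 - A $ 1 $ 2 * A $ 2 $ 1 = 1"
    using assms by (simp add: SL2_def det_2)
  have "det ?B = 1" using det by (simp add: det_2 mat_def algebra_simps)
  then have B: "?B \<in> carrier SL2" by (simp add: SL2_def)
  have "?B ** A = mat 1"
    using det by (simp add: vec_eq_iff forall_2 matrix_matrix_mult_def sum_2 mat_def algebra_simps)
  then have "?B \<otimes>\<^bsub>SL2\<^esub> A = \<one>\<^bsub>SL2\<^esub>" by (simp add: SL2_def)
  then show ?thesis using assms B by (simp add: SL2.inv_equality)
qed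

definition rep_indices :: "nat \<Rightarrow> rep_index set" where
  "rep_indices n = {..<n} \<times> UNIV \<times> UNIV"

text \<open>The points of the \<open>n\<close>-fold product of \<open>SL\<^sub>2\<close>, that is, the representations of
  the free group.\<close>

definition SL2_tuples :: "nat \<Rightarrow> (rep_index \<Rightarrow> complex) set" where
  "SL2_tuples n = {p \<in> affine_space (rep_indices n). \<forall>k<n. matrix_at p k \<in> carrier SL2}"

lemma rep_variety_eq:
  "rep_variety G xs = (rep_indices (length xs),
     {p \<in> SL2_tuples (length xs). \<forall>w\<in>relations G xs. word_val SL2 (matrix_at p) w = \<one>\<^bsub>SL2\<^esub>})"
  by (simp add: rep_variety_def Let_def rep_indices_def SL2_tuples_def)

lemma fst_rep_variety: "fst (rep_variety G xs) = rep_indices (length xs)"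
  by (simp add: rep_variety_eq)

lemma rep_variety_subset_affine:
  "snd (rep_variety G xs) \<subseteq> affine_space (fst (rep_variety G xs))"
  by (auto simp: rep_variety_eq SL2_tuples_def)

lemma poly_fun_uminus: "f \<in> poly_fun I \<Longrightarrow> (\<lambda>x. - f x) \<in> poly_fun I"
  using poly_fun.mult[OF poly_fun.const[of "- 1"]] by simp

lemma poly_fun_diff: "f \<in> poly_fun I \<Longrightarrow> g \<in> poly_fun I \<Longrightarrow> (\<lambda>x. f x - g x) \<in> poly_fun I"
  using poly_fun.add[OF _ poly_fun_uminus, of f I g] by simp

lemma poly_fun_matrix_entry:
  "k < n \<Longrightarrow> (\<lambda>p. matrix_at p k $ i $ j) \<in> poly_fun (rep_indices n)"
  using poly_fun.coord[of "(k, i, j)" "rep_indices n"] by (simp add: matrix_at_def rep_indices_def)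

lemma poly_fun_letter_entry:
  assumes "k < n"
  shows "\<exists>f\<in>poly_fun (rep_indices n). \<forall>p\<in>SL2_tuples n.
    (if b then matrix_at p k else inv\<^bsub>SL2\<^esub> (matrix_at p k)) $ i $ j = f p"
proof (cases b)
  case True
  then show ?thesis using poly_fun_matrix_entry[OF assms] by (intro bexI) auto
next
  case False
  define f where "f p = (if i = j then matrix_at p k $ 1 $ 1 + matrix_at p k $ 2 $ 2 else 0)
    - matrix_at p k $ i $ j" for p
  have "f \<in> poly_fun (rep_indices n)"
    unfolding f_def using poly_fun_matrix_entry[OF assms]
    by (cases "i = j") (simp_all add: poly_fun_diff poly_fun.add poly_fun.const poly_fun_uminus)
  moreover have "(inv\<^bsub>SL2\<^esub> (matrix_at p k)) $ i $ j = f p" if "p \<in> SL2_tuples n" for p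
    using that assms by (simp add: SL2_tuples_def inv_SL2 f_def mat_def)
  ultimately show ?thesis using False by (intro bexI) auto
qed

text \<open>The polynomial represents the entry only on tuples of determinant \<open>1\<close>, where inverses
  are given by \<open>inv_SL2\<close>.\<close>

lemma poly_fun_word_entry:
  assumes "w \<in> words n"
  shows "\<exists>f\<in>poly_fun (rep_indices n). \<forall>p\<in>SL2_tuples n. word_val SL2 (matrix_at p) w $ i $ j = f p"
  using assms
proof (induction w arbitrary: i j)
  case Nil
  show ?case
    by (rule bexI[OF _ poly_fun.const[of "mat 1 $ i $ j"]]) (simp add: SL2_def)
next
  case (Cons a w)
  obtain k b where a: "a = (k, b)" by (cases a)
  from Cons.prems have w: "w \<in> words n" and k: "k < n" by (auto simp: words_def a)
  let ?L = "\<lambda>p. if b then matrix_at p k else inv\<^bsub>SL2\<^esub> (matrix_at p k)"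
  obtain f where f: "\<And>l. f l \<in> poly_fun (rep_indices n)"
    "\<And>l p. p \<in> SL2_tuples n \<Longrightarrow> ?L p $ i $ l = f l p"
    using poly_fun_letter_entry[OF k, of b i] by metis
  obtain g where g: "\<And>l. g l \<in> poly_fun (rep_indices n)"
    "\<And>l p. p \<in> SL2_tuples n \<Longrightarrow> word_val SL2 (matrix_at p) w $ l $ j = g l p"
    using Cons.IH[OF w, of _ j] by metis
  have "word_val SL2 (matrix_at p) (a # w) $ i $ j = f 1 p * g 1 p + f 2 p * g 2 p"
    if "p \<in> SL2_tuples n" for p
  proof -
    have "word_val SL2 (matrix_at p) (a # w) $ i $ j
        = (?L p ** word_val SL2 (matrix_at p) w) $ i $ j"
      by (simp add: a SL2_def)
    also have "\<dots> = f 1 p * g 1 p + f 2 p * g 2 p"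
      unfolding matrix_matrix_mult_def using f(2)[OF that] g(2)[OF that] by (simp add: sum_2)
    finally show ?thesis .
  qed
  then show ?case
    using f(1) g(1)
    by (intro bexI[of _ "\<lambda>p. f 1 p * g 1 p + f 2 p * g 2 p"]) (auto intro!: poly_fun.add poly_fun.mult)
qed

text \<open>The variety is the common zero locus of all polynomials that vanish on it. Among these are
  the equations \<open>det = 1\<close>. They force a common zero to be a tuple in \<open>SL\<^sub>2\<close>, where
  the entries of words are polynomials, and then the polynomials of the relations apply.\<close>

lemma closedin_rep_variety:
  "closedin (zariski (rep_indices (length xs))) (snd (rep_variety G xs))"
proof -
  let ?n = "length xs" and ?V = "snd (rep_variety G xs)"
  let ?I = "rep_indices ?n"
  let ?F = "{f \<in> poly_fun ?I. \<forall>p\<in>?V. f p = 0}"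
  have "?V = zero_locus ?I ?F"
  proof (intro equalityI subsetI)
    fix p assume "p \<in> ?V"
    then show "p \<in> zero_locus ?I ?F"
      using rep_variety_subset_affine[of G xs] by (auto simp: zero_locus_def fst_rep_variety)
  next
    fix p assume p: "p \<in> zero_locus ?I ?F"
    have vanish: "f p = 0" if "f \<in> poly_fun ?I" "\<And>q. q \<in> ?V \<Longrightarrow> f q = 0" for f
      using p that by (auto simp: zero_locus_def)
    have "matrix_at p k \<in> carrier SL2" if k: "k < ?n" for k
    proof -
      have "(\<lambda>q. matrix_at q k $ 1 $ 1 * matrix_at q k $ 2 $ 2
          - matrix_at q k $ 1 $ 2 * matrix_at q k $ 2 $ 1 - 1) \<in> poly_fun ?I"
        by (intro poly_fun_diff poly_fun.mult poly_fun_matrix_entry k poly_fun.const)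
      then have "matrix_at p k $ 1 $ 1 * matrix_at p k $ 2 $ 2
          - matrix_at p k $ 1 $ 2 * matrix_at p k $ 2 $ 1 - 1 = 0"
        by (rule vanish) (use k in \<open>simp add: rep_variety_eq SL2_tuples_def SL2_def det_2\<close>)
      then show ?thesis by (simp add: SL2_def det_2)
    qed
    then have p': "p \<in> SL2_tuples ?n" using p by (simp add: SL2_tuples_def zero_locus_def)
    have "word_val SL2 (matrix_at p) w = \<one>\<^bsub>SL2\<^esub>" if w: "w \<in> relations G xs" for w
    proof -
      have "word_val SL2 (matrix_at p) w $ i $ j = mat 1 $ i $ j" for i j
      proof -
        have "w \<in> words ?n" using w by (simp add: relations_def)
        then obtain f where f: "f \<in> poly_fun ?I"
          "\<And>q. q \<in> SL2_tuples ?n \<Longrightarrow> word_val SL2 (matrix_at q) w $ i $ j = f q"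
          using poly_fun_word_entry by blast
        have "(\<lambda>q. f q - mat 1 $ i $ j) \<in> poly_fun ?I"
          by (intro poly_fun_diff f poly_fun.const)
        then have "f p - mat 1 $ i $ j = 0"
        proof (rule vanish)
          fix q assume "q \<in> ?V"
          then have "q \<in> SL2_tuples ?n" "word_val SL2 (matrix_at q) w = mat 1"
            using w by (auto simp: rep_variety_eq SL2_def)
          then show "f q - mat 1 $ i $ j = 0" using f(2)[of q] by simp
        qed
        then show ?thesis using f(2)[OF p'] by simp
      qed
      then show ?thesis by (simp add: vec_eq_iff SL2_def)
    qed
    with p' show "p \<in> ?V" by (simp add: rep_variety_eq)
  qed
  moreover have "?F \<subseteq> poly_fun ?I" by (rule Collect_restrict)
  ultimately show ?thesis unfolding closedin_zariski_iff by (intro exI[of _ ?F] conjI)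
qed

text \<open>The tuple of matrices obtained by evaluating the words \<open>v 0, \<dots>, v (m - 1)\<close> at the tuple
  \<open>p\<close>. The restriction makes the result a point of affine space, whose points are undefined
  outside the index set.\<close>

definition word_map :: "nat \<Rightarrow> (nat \<Rightarrow> group_word) \<Rightarrow> (rep_index \<Rightarrow> complex) \<Rightarrow> rep_index \<Rightarrow> complex"
  where "word_map m v p = restrict (\<lambda>(k, i, j). word_val SL2 (matrix_at p) (v k) $ i $ j) (rep_indices m)"

lemma matrix_at_word_map:
  "k < m \<Longrightarrow> matrix_at (word_map m v p) k = word_val SL2 (matrix_at p) (v k)"
  by (simp add: matrix_at_def word_map_def rep_indices_def vec_eq_iff)

lemma word_val_word_map:
  assumes "p \<in> SL2_tuples n" "w \<in> words m" "\<And>k. k < m \<Longrightarrow> v k \<in> words n"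
  shows "word_val SL2 (matrix_at (word_map m v p)) w = word_val SL2 (matrix_at p) (subst_word v w)"
proof -
  interpret SL2: Group.group SL2 by (rule group_SL2)
  have "word_val SL2 (matrix_at (word_map m v p)) w
      = word_val SL2 (\<lambda>k. word_val SL2 (matrix_at p) (v k)) w"
    by (rule word_val_cong[OF assms(2)]) (simp add: matrix_at_word_map)
  also have "\<dots> = word_val SL2 (matrix_at p) (subst_word v w)"
    using assms by (intro SL2.word_val_subst_word[symmetric]) (auto simp: SL2_tuples_def)
  finally show ?thesis .
qed

lemma word_map_SL2_tuples:
  assumes "p \<in> SL2_tuples n" "\<And>k. k < m \<Longrightarrow> v k \<in> words n"
  shows "word_map m v p \<in> SL2_tuples m"
proof -
  interpret SL2: Group.group SL2 by (rule group_SL2)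
  have "word_val SL2 (matrix_at p) (v k) \<in> carrier SL2" if "k < m" for k
    using assms that by (intro SL2.word_val_closed[of _ n]) (auto simp: SL2_tuples_def)
  moreover have "word_map m v p \<in> affine_space (rep_indices m)"
    by (simp add: affine_space_def word_map_def)
  ultimately show ?thesis by (simp add: SL2_tuples_def matrix_at_word_map)
qed

lemma word_val_change_generators:
  assumes "Group.group H" "set xs \<subseteq> carrier H" "length ys = m"
    and v: "\<And>k. k < m \<Longrightarrow> v k \<in> words (length xs)"
      "\<And>k. k < m \<Longrightarrow> word_val H (\<lambda>k. xs ! k) (v k) = ys ! k"
    and w: "w \<in> words m"
  shows "word_val H (\<lambda>k. xs ! k) (subst_word v w) = word_val H (\<lambda>k. ys ! k) w"
proof -
  interpret H: Group.group H by (rule assms(1))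
  have "word_val H (\<lambda>k. xs ! k) (subst_word v w)
      = word_val H (\<lambda>k. word_val H (\<lambda>k. xs ! k) (v k)) w"
    using assms(2) by (intro H.word_val_subst_word[OF w v(1)]) auto
  also have "\<dots> = word_val H (\<lambda>k. ys ! k) w"
    by (rule word_val_cong[OF w]) (rule v(2))
  finally show ?thesis .
qed

text \<open>If the generators \<open>ys\<close> are the words \<open>v\<close> in the generators \<open>xs\<close>,
  substituting \<open>v\<close> turns relations of \<open>ys\<close> into relations of \<open>xs\<close>, which
  hold at every point of the source.\<close>

lemma regular_map_word_map:
  assumes H: "Group.group H" "set xs \<subseteq> carrier H"
    and v: "\<And>k. k < length ys \<Longrightarrow> v k \<in> words (length xs)"
      "\<And>k. k < length ys \<Longrightarrow> word_val H (\<lambda>k. xs ! k) (v k) = ys ! k"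
  shows "regular_map (rep_variety H xs) (rep_variety H ys) (word_map (length ys) v)"
  unfolding regular_map_def
proof (intro conjI ballI image_subsetI)
  fix p assume "p \<in> snd (rep_variety H xs)"
  then have p: "p \<in> SL2_tuples (length xs)"
    and rel: "\<And>w. w \<in> relations H xs \<Longrightarrow> word_val SL2 (matrix_at p) w = \<one>\<^bsub>SL2\<^esub>"
    by (auto simp: rep_variety_eq)
  have "word_val SL2 (matrix_at (word_map (length ys) v p)) w = \<one>\<^bsub>SL2\<^esub>"
    if w: "w \<in> relations H ys" for w
  proof -
    have w': "w \<in> words (length ys)" using w by (simp add: relations_def)
    have "subst_word v w \<in> relations H xs"
      using w words_subst_word[OF w' v(1)] word_val_change_generators[OF H refl v w']
      by (simp add: relations_def)
    then show ?thesis using word_val_word_map[OF p w' v(1)] rel by simp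
  qed
  then show "word_map (length ys) v p \<in> snd (rep_variety H ys)"
    using word_map_SL2_tuples[OF p v(1)] by (simp add: rep_variety_eq)
next
  fix a assume "a \<in> fst (rep_variety H ys)"
  then obtain k i j where a: "a = (k, i, j)" "k < length ys" "a \<in> rep_indices (length ys)"
    by (auto simp: fst_rep_variety rep_indices_def)
  obtain f where "f \<in> poly_fun (rep_indices (length xs))"
    "\<And>p. p \<in> SL2_tuples (length xs) \<Longrightarrow> word_val SL2 (matrix_at p) (v k) $ i $ j = f p"
    using poly_fun_word_entry[OF v(1)[OF a(2)]] by blast
  then show "\<exists>f\<in>poly_fun (fst (rep_variety H xs)). \<forall>p\<in>snd (rep_variety H xs).
      word_map (length ys) v p a = f p"
    using a(3) by (intro bexI[of _ f]) (auto simp: a(1) word_map_def rep_variety_eq)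
qed

text \<open>Let \<open>w\<^sub>k\<close> arise from \<open>u\<^sub>k\<close> by substituting \<open>v\<close>. Then
  \<open>w\<^sub>k\<close> expresses \<open>x\<^sub>k\<close> in terms of \<open>xs\<close> itself, so that
  \<open>w\<^sub>k x\<^sub>k\<inverse>\<close> is a relation. The points of the variety satisfy it, which says that
  the composition of the two evaluations fixes every matrix of \<open>p\<close>.\<close>

lemma word_map_inverse:
  assumes H: "Group.group H" "set xs \<subseteq> carrier H"
    and v: "\<And>k. k < length ys \<Longrightarrow> v k \<in> words (length xs)"
      "\<And>k. k < length ys \<Longrightarrow> word_val H (\<lambda>k. xs ! k) (v k) = ys ! k"
    and u: "\<And>k. k < length xs \<Longrightarrow> u k \<in> words (length ys)"
      "\<And>k. k < length xs \<Longrightarrow> word_val H (\<lambda>k. ys ! k) (u k) = xs ! k"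
    and p: "p \<in> snd (rep_variety H xs)"
  shows "word_map (length xs) u (word_map (length ys) v p) = p"
proof -
  interpret H: Group.group H by (rule H(1))
  interpret SL2: Group.group SL2 by (rule group_SL2)
  let ?n = "length xs"
  have p': "p \<in> SL2_tuples ?n"
    and rel: "\<And>w. w \<in> relations H xs \<Longrightarrow> word_val SL2 (matrix_at p) w = \<one>\<^bsub>SL2\<^esub>"
    using p by (auto simp: rep_variety_eq)
  have SL: "\<And>k. k < ?n \<Longrightarrow> matrix_at p k \<in> carrier SL2" using p' by (simp add: SL2_tuples_def)
  have x: "\<And>k. k < ?n \<Longrightarrow> xs ! k \<in> carrier H" using H(2) by auto
  let ?q = "word_map ?n u (word_map (length ys) v p)"
  have "matrix_at ?q k = matrix_at p k" if k: "k < ?n" for k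
  proof -
    let ?w = "subst_word v (u k)"
    have w: "?w \<in> words ?n" using words_subst_word[OF u(1)[OF k] v(1)] .
    have kw: "[(k, False)] \<in> words ?n" using k by (simp add: words_def)
    have "word_val H (\<lambda>k. xs ! k) ?w = xs ! k"
      using word_val_change_generators[OF H refl v u(1)[OF k]] u(2)[OF k] by simp
    then have "word_val H (\<lambda>k. xs ! k) (?w @ [(k, False)]) = \<one>\<^bsub>H\<^esub>"
      using H.word_val_append[OF w kw x] x[OF k] by simp
    then have "?w @ [(k, False)] \<in> relations H xs"
      using words_append[OF w kw] by (simp add: relations_def)
    then have "word_val SL2 (matrix_at p) ?w \<otimes>\<^bsub>SL2\<^esub> inv\<^bsub>SL2\<^esub> (matrix_at p k) = \<one>\<^bsub>SL2\<^esub>"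
      using rel SL2.word_val_append[OF w kw, of "matrix_at p"] SL SL[OF k] by simp
    then have "inv\<^bsub>SL2\<^esub> (inv\<^bsub>SL2\<^esub> (matrix_at p k)) = word_val SL2 (matrix_at p) ?w"
      using SL2.word_val_closed[OF w, of "matrix_at p"] SL SL[OF k] by (intro SL2.inv_equality) auto
    then have "word_val SL2 (matrix_at p) ?w = matrix_at p k" using SL[OF k] by simp
    moreover have "matrix_at ?q k = word_val SL2 (matrix_at p) ?w"
      using matrix_at_word_map[OF k] word_val_word_map[OF p' u(1)[OF k] v(1)] by simp
    ultimately show ?thesis by simp
  qed
  then have eq: "?q (k, i, j) = p (k, i, j)" if "k < ?n" for k i j
    using that by (simp add: matrix_at_def vec_eq_iff)
  show ?thesis
  proof
    fix a :: rep_index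
    obtain k i j where a: "a = (k, i, j)" by (cases a)
    show "?q a = p a"
    proof (cases "k < ?n")
      case True
      then show ?thesis using eq a by simp
    next
      case False
      then have a: "a \<notin> rep_indices ?n" by (simp add: a rep_indices_def)
      have "?q \<in> affine_space (rep_indices ?n)" "p \<in> affine_space (rep_indices ?n)"
        using p' by (auto simp: SL2_tuples_def word_map_def affine_space_def)
      then have "?q a = undefined" and "p a = undefined"
        unfolding affine_space_def using a by (blast intro: PiE_arb)+
      then show ?thesis by simp
    qed
  qed
qed

lemma rep_variety_independent_of_generators:
  assumes H: "Group.group H" and xs: "generating_tuple H xs" and ys: "generating_tuple H ys"
  shows "isomorphic_varieties (rep_variety H xs) (rep_variety H ys)"
proof -
  have x: "set xs \<subseteq> carrier H" and y: "set ys \<subseteq> carrier H"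
    using xs ys by (simp_all add: generating_tuple_def)
  have "\<exists>w. k < length ys \<longrightarrow> w \<in> words (length xs) \<and> word_val H (\<lambda>k. xs ! k) w = ys ! k" for k
    using xs y unfolding generating_tuple_iff_words[OF H] by (metis nth_mem subsetD)
  then obtain v where v: "\<And>k. k < length ys \<Longrightarrow> v k \<in> words (length xs)"
    "\<And>k. k < length ys \<Longrightarrow> word_val H (\<lambda>k. xs ! k) (v k) = ys ! k" by metis
  have "\<exists>w. k < length xs \<longrightarrow> w \<in> words (length ys) \<and> word_val H (\<lambda>k. ys ! k) w = xs ! k" for k
    using ys x unfolding generating_tuple_iff_words[OF H] by (metis nth_mem subsetD)
  then obtain u where u: "\<And>k. k < length xs \<Longrightarrow> u k \<in> words (length ys)"
    "\<And>k. k < length xs \<Longrightarrow> word_val H (\<lambda>k. ys ! k) (u k) = xs ! k" by metis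
  show ?thesis
    unfolding isomorphic_varieties_def
    using regular_map_word_map[OF H x v] regular_map_word_map[OF H y u]
      word_map_inverse[OF H x v u] word_map_inverse[OF H y u v] by blast
qed

text \<open>For the images in \<open>G / N\<close> of the generators of \<open>G\<close>, the relations of
  \<open>G\<close> persist and further ones are added: the variety of the quotient is a closed subset of
  that of \<open>G\<close> in the same affine space.\<close>

theorem num_components_quotient_le:
  assumes G: "Group.group G" and N: "N \<lhd> G"
    and xs: "generating_tuple G xs" and ys: "generating_tuple (G Mod N) ys"
    and dim: "Dim (rep_variety G xs) = ereal (of_int c)"
  shows "num_components c (rep_variety (G Mod N) ys) \<le> num_components c (rep_variety G xs)"
proof -
  interpret normal N G by (rule N)
  interpret Q: Group.group "G Mod N" by (rule factorgroup_is_group)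
  interpret \<pi>: group_hom G "G Mod N" "\<lambda>a. N #>\<^bsub>G\<^esub> a"
    by unfold_locales (rule r_coset_hom_Mod)
  let ?zs = "map (\<lambda>a. N #>\<^bsub>G\<^esub> a) xs"
  have "(\<lambda>a. N #>\<^bsub>G\<^esub> a) ` carrier G = carrier (G Mod N)"
    by (auto simp: FactGroup_def RCOSETS_def)
  then have zs: "generating_tuple (G Mod N) ?zs"
    using xs by (intro \<pi>.generating_tuple_map_hom)
  have "num_components c (rep_variety (G Mod N) ys) = num_components c (rep_variety (G Mod N) ?zs)"
    by (intro num_components_isomorphic rep_variety_independent_of_generators
        rep_variety_subset_affine zs ys Q.is_group)
  also have "\<dots> \<le> num_components c (rep_variety G xs)"
  proof -
    let ?I = "rep_indices (length xs)"
    let ?V = "snd (rep_variety G xs)" and ?W = "snd (rep_variety (G Mod N) ?zs)"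
    have eq: "rep_variety G xs = (?I, ?V)" "rep_variety (G Mod N) ?zs = (?I, ?W)"
      by (simp_all add: rep_variety_eq)
    have "set xs \<subseteq> carrier G" using xs by (simp add: generating_tuple_def)
    then have "?W \<subseteq> ?V"
      using \<pi>.relations_map_hom[of xs] by (auto simp: rep_variety_eq)
    moreover have "closedin (zariski ?I) ?W"
      using closedin_rep_variety[of ?zs "G Mod N"] by simp
    moreover have "finite ?I" by (simp add: rep_indices_def)
    ultimately show ?thesis
      using num_components_closed_subset[of ?I ?W ?V c] closedin_rep_variety[of xs G] dim
      by (simp flip: eq)
  qed
  finally show ?thesis .
qed


section \<open>Extracting the subsequence\<close>

lemma strict_mono_subsequence_of_unbounded:
  fixes f g :: "nat \<Rightarrow> nat"
  assumes le: "\<And>i. g i \<le> f i" and inf: "infinite (range g)"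
  shows "\<exists>s :: nat \<Rightarrow> nat. strict_mono s \<and> strict_mono (\<lambda>j. f (s j))"
proof -
  have step: "\<exists>n>m. f m < f n" for m
  proof (rule ccontr)
    assume *: "\<not> (\<exists>n>m. f m < f n)"
    have "g n \<le> f m" if "n > m" for n
    proof -
      have "\<not> f m < f n" using * that by blast
      then show ?thesis using le[of n] by simp
    qed
    then have "g n \<in> g ` {..m} \<union> {..f m}" for n by (cases "n \<le> m") auto
    then have "range g \<subseteq> g ` {..m} \<union> {..f m}" by blast
    then show False using inf finite_subset by blast
  qed
  have "\<exists>s. \<forall>n. True \<and> s n < s (Suc n) \<and> f (s n) < f (s (Suc n))"
    by (rule dependent_nat_choice) (use step in auto)
  then obtain s where "\<And>n. s n < s (Suc n)" "\<And>n. f (s n) < f (s (Suc n))" by blast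
  then show ?thesis by (intro exI[of _ s]) (simp add: strict_mono_Suc_iff)
qed

lemma well_order_on_by_nat_measure:
  fixes \<mu> :: "'a \<Rightarrow> nat"
  assumes "inj_on \<mu> S"
  shows "well_order_on S {(x, y). x \<in> S \<and> y \<in> S \<and> \<mu> x \<le> \<mu> y}" (is "well_order_on S ?r")
proof -
  have "?r - Id \<subseteq> Wellfounded.measure \<mu>"
  proof (rule subrelI)
    fix x y assume "(x, y) \<in> ?r - Id"
    then have "x \<in> S" "y \<in> S" "x \<noteq> y" "\<mu> x \<le> \<mu> y" by auto
    then show "(x, y) \<in> Wellfounded.measure \<mu>" using inj_onD[OF assms, of x y] by fastforce
  qed
  then have "wf (?r - Id)" by (rule wf_subset[OF wf_measure])
  moreover have "antisym ?r" using assms by (auto simp: antisym_def inj_on_def)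
  moreover have "refl_on S ?r" "trans ?r" "total_on S ?r" "?r \<subseteq> S \<times> S"
    by (auto simp: refl_on_def trans_def total_on_def)
  ultimately show ?thesis
    by (simp add: well_order_on_def linear_order_on_def partial_order_on_def preorder_on_def)
qed

theorem theorem1p0:
  fixes G :: "nat \<Rightarrow> ('g, 'm) monoid_scheme"
    and N :: "nat \<Rightarrow> 'g set"
    and c :: int
    and gens :: "('g, 'm) monoid_scheme \<Rightarrow> 'g list"
    and qgens :: "nat \<Rightarrow> 'g set list"
  defines "R \<equiv> \<lambda>H. rep_variety H (gens H)"
    and "RQ \<equiv> \<lambda>i. rep_variety (G i Mod N i) (qgens i)"
  assumes "\<And>i. group (G i)"
    and "\<And>i. N i \<lhd> G i"
    and "\<And>i. generating_tuple (G i) (gens (G i))"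
    and "\<And>i. generating_tuple (G i Mod N i) (qgens i)"
    and "\<And>i. Dim (R (G i)) = ereal (of_int c)"
    and "\<And>i. Dim (RQ i) = ereal (of_int c)"
    and "infinite {num_components c (RQ i) | i. True}"
  shows "\<exists>s :: nat \<Rightarrow> nat. strict_mono s \<and>
      (\<forall>j k. j \<noteq> k \<longrightarrow> num_components c (R (G (s j))) \<noteq> num_components c (R (G (s k)))) \<and>
      (\<forall>j k. j \<noteq> k \<longrightarrow> \<not> isomorphic_varieties (R (G (s j))) (R (G (s k)))) \<and>
      (let S\<^sub>2 = {G (s j) | j. True} in
       well_order_on S\<^sub>2 {(H, K). H \<in> S\<^sub>2 \<and> K \<in> S\<^sub>2 \<and> num_components c (R H) \<le> num_components c (R K)})"
proof -
  define f where "f i = num_components c (R (G i))" for i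
  have "num_components c (RQ i) \<le> f i" for i
    unfolding f_def R_def RQ_def
    using assms(3-7) by (intro num_components_quotient_le) (simp_all add: R_def)
  moreover have "infinite (range (\<lambda>i. num_components c (RQ i)))"
    using assms(9) by (simp add: full_SetCompr_eq)
  ultimately obtain s :: "nat \<Rightarrow> nat" where s: "strict_mono s" "strict_mono (\<lambda>j. f (s j))"
    using strict_mono_subsequence_of_unbounded[of "\<lambda>i. num_components c (RQ i)" f] by blast
  have neq: "f (s j) \<noteq> f (s k)" if "j \<noteq> k" for j k
    using strict_mono_imp_inj_on[OF s(2)] that by (auto dest: injD)
  have "\<not> isomorphic_varieties (R (G (s j))) (R (G (s k)))" if "j \<noteq> k" for j k
  proof
    assume "isomorphic_varieties (R (G (s j))) (R (G (s k)))"
    then have "f (s j) = f (s k)"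
      unfolding f_def R_def by (intro num_components_isomorphic rep_variety_subset_affine)
    then show False using neq[OF that] by simp
  qed
  moreover have inj: "inj_on (\<lambda>H. num_components c (R H)) {G (s j) | j. True}"
  proof (rule inj_onI)
    fix H K
    assume "H \<in> {G (s j) | j. True}" "K \<in> {G (s j) | j. True}"
      and eq: "num_components c (R H) = num_components c (R K)"
    then obtain j k where "H = G (s j)" "K = G (s k)" by blast
    with eq neq[of j k] show "H = K" by (cases "j = k") (simp_all add: f_def)
  qed
  ultimately show ?thesis
    using s(1) neq well_order_on_by_nat_measure[OF inj]
    unfolding f_def Let_def by (intro exI[of _ s] conjI allI impI)
qed

end
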